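(* Let $n\ge1$. There is a surjective group homomorphism $\varphi\colon D_{4n}\to G=\{1,m,r,mr\}$ determined by $\varphi(\rho)=m$ and $\varphi(\tau)=mr$. Moreover, for every word $c=(a_1,b_1,\dots,a_n,b_n)$ of length $2n$, with $$\beta_c=\sigma_1^{a_1}\sigma_2^{-b_1}\sigma_1^{a_2}\sigma_2^{-b_2}\cdots\sigma_1^{a_n}\sigma_2^{-b_n}\in B_3,$$ the following hold (equalities of closures being equalities of oriented link types): (a) $\widehat{\beta_{\rho(c)}}=m(\widehat{\beta_c})$. (b) $\widehat{\beta_{\tau(c)}}=mr(\widehat{\beta_c})$. (c) $\widehat{\beta_{g(c)}}=\varphi(g)(\widehat{\beta_c})$ for every $g\in D_{4n}$. (d) $\beta_{\rho^2(c)}$ is conjugate to $\beta_c$ in $B_3$; hence $\beta_{\rho^{2j}(c)}$ is conjugate to $\beta_c$ for every $j\in\mathbb{Z}$. In particular $\widehat{\beta_{\rho^{2j}(c)}}=\widehat{\beta_c}$ for every $j\in\mathbb{Z}$.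
   Context: $B_3$ is the Artin braid group on three strands with standard generators $\sigma_1,\sigma_2$ and relation $\sigma_1\sigma_2\sigma_1=\sigma_2\sigma_1\sigma_2$; $\widehat\beta$ is the closure of the braid $\beta$, an oriented link (strands oriented from top to bottom). The operations on oriented links in $S^3$: $m$ is the mirror image (flip every crossing, keep the orientation of the link) and $r$ reverses the orientation of the link (of all components). They generate the operation group $G=\{1,m,r,mr\}\cong\mathbb{Z}/2\times\mathbb{Z}/2$. A word of length $2n$ is a finite sequence $c=(c_1,\dots,c_{2n})$ of positive integers, with indices read modulo $2n$ (representatives in $\{1,\dots,2n\}$); write $a_i=c_{2i-1}$, $b_i=c_{2i}$. The rotation is $\rho(c)_i=c_{i+1}$, i.e. $\rho(a_1,b_1,a_2,b_2,\dots,a_n,b_n)=(b_1,a_2,b_2,\dots,a_n,b_n,a_1)$, and the reflection is $\tau(c)_i=c_{2n+1-i}$, i.e. $\tau(a_1,b_1,\dots,a_n,b_n)=(b_n,a_n,\dots,b_1,a_1)$. These satisfy $\rho^{2n}=\tau^2=1$ and $\tau\rho\tau^{-1}=\rho^{-1}$. $D_{4n}$ denotes the dihedral group of order $4n$, $D_{4n}=\langle\rho,\tau\mid\rho^{2n}=\tau^2=1,\ \tau\rho\tau^{-1}=\rho^{-1}\rangle$, acting (on the left) on the set of words of length $2n$ through these operations. *)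

theory Defs
  imports "HOL-Analysis.Analysis" "HOL-Algebra.Coset"
begin

section \<open>The braid group on three strands\<close>

datatype braid_gen = Sigma1 | Sigma2

text \<open>The letter (x, True) stands for the generator x, and (x, False) for its inverse.\<close>

type_synonym braid_word = "(braid_gen \<times> bool) list"

inductive braid_step :: "braid_word \<Rightarrow> braid_word \<Rightarrow> bool" where
  cancel: "braid_step (u @ [(x, e), (x, \<not> e)] @ v) (u @ v)"
| artin: "braid_step (u @ [(Sigma1, True), (Sigma2, True), (Sigma1, True)] @ v)
                     (u @ [(Sigma2, True), (Sigma1, True), (Sigma2, True)] @ v)"

lemma braid_step_context: "braid_step u v \<Longrightarrow> braid_step (x @ u @ y) (x @ v @ y)"
proof (induction rule: braid_step.induct)
  case (cancel u g e v)
  show ?case using braid_step.cancel[of "x @ u" g e "v @ y"] by simp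
next
  case (artin u v)
  show ?case using braid_step.artin[of "x @ u" "v @ y"] by simp
qed

lemma braid_equiv_context:
  "equivclp braid_step u v \<Longrightarrow> equivclp braid_step (x @ u @ y) (x @ v @ y)"
proof (induction rule: equivclp_induct)
  case base
  show ?case by (rule equivclp_refl)
next
  case (step v w)
  then have "equivclp braid_step (x @ v @ y) (x @ w @ y)"
    by (meson braid_step_context converse_r_into_equivclp r_into_equivclp)
  with step.IH show ?case by (rule equivclp_trans)
qed

quotient_type braid = braid_word / "equivclp braid_step"
  morphisms rep_braid braid_of
  by (rule equivp_evquivclp)

lift_definition braid_mult :: "braid \<Rightarrow> braid \<Rightarrow> braid" is "(@)"
proof -
  fix u u' v v' :: braid_word
  assume "equivclp braid_step u u'" and "equivclp braid_step v v'"
  then have "equivclp braid_step ([] @ u @ v) ([] @ u' @ v)"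
    and "equivclp braid_step (u' @ v @ []) (u' @ v' @ [])"
    by (blast intro: braid_equiv_context)+
  then show "equivclp braid_step (u @ v) (u' @ v')"
    by (simp, metis equivclp_trans)
qed

definition B3 :: "braid monoid" where
  "B3 = \<lparr>carrier = UNIV, mult = braid_mult, one = braid_of []\<rparr>"

definition word_inv :: "braid_word \<Rightarrow> braid_word" where
  "word_inv w = rev (map (\<lambda>(x, e). (x, \<not> e)) w)"

lemma word_inv_append: "equivclp braid_step (word_inv w @ w) []"
proof (induction w)
  case Nil
  show ?case by (simp add: word_inv_def equivclp_refl)
next
  case (Cons a w)
  obtain x e where a: "a = (x, e)" by force
  have "braid_step (word_inv w @ [(x, \<not> e), (x, \<not> \<not> e)] @ w) (word_inv w @ w)"
    by (rule braid_step.cancel)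
  then have "equivclp braid_step (word_inv (a # w) @ a # w) (word_inv w @ w)"
    by (simp add: word_inv_def a r_into_equivclp)
  then show ?case using Cons.IH by (rule equivclp_trans)
qed

lemma group_B3: "group B3"
proof (rule groupI)
  fix x y z assume "x \<in> carrier B3" "y \<in> carrier B3" "z \<in> carrier B3"
  show "x \<otimes>\<^bsub>B3\<^esub> y \<otimes>\<^bsub>B3\<^esub> z = x \<otimes>\<^bsub>B3\<^esub> (y \<otimes>\<^bsub>B3\<^esub> z)"
    unfolding B3_def by (simp, transfer, simp add: equivclp_refl)
next
  fix x assume "x \<in> carrier B3"
  show "\<one>\<^bsub>B3\<^esub> \<otimes>\<^bsub>B3\<^esub> x = x"
    unfolding B3_def by (simp, transfer, simp add: equivclp_refl)
  have "braid_mult (braid_of (word_inv (rep_braid x))) x = braid_of []"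
  proof -
    obtain w where x: "x = braid_of w" by (metis Quotient3_abs_rep Quotient3_braid)
    have "braid_mult (braid_of (word_inv w)) x = braid_of []"
      unfolding x by (simp add: braid_mult.abs_eq word_inv_append braid.abs_eq_iff)
    then show ?thesis
      by (metis Quotient3_abs_rep Quotient3_braid braid.abs_eq_iff braid_mult.abs_eq word_inv_append)
  qed
  then show "\<exists>y\<in>carrier B3. y \<otimes>\<^bsub>B3\<^esub> x = \<one>\<^bsub>B3\<^esub>"
    unfolding B3_def by auto
qed (auto simp: B3_def)

definition sigma1 :: braid where "sigma1 = braid_of [(Sigma1, True)]"
definition sigma2 :: braid where "sigma2 = braid_of [(Sigma2, True)]"

definition conjugate_in_B3 :: "braid \<Rightarrow> braid \<Rightarrow> bool" where
  "conjugate_in_B3 x y \<longleftrightarrow> (\<exists>g\<in>carrier B3. x = g \<otimes>\<^bsub>B3\<^esub> y \<otimes>\<^bsub>B3\<^esub> inv\<^bsub>B3\<^esub> g)"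


section \<open>Words and the dihedral group\<close>

text \<open>A word is a list; its rotation is \<^const>\<open>rotate1\<close> and its reflection is \<^const>\<open>rev\<close>.\<close>

definition words :: "nat \<Rightarrow> nat list set" where
  "words n = {c. length c = 2 * n \<and> (\<forall>x\<in>set c. 0 < x)}"

text \<open>Words have even length, so the clause for singleton lists is irrelevant.\<close>

fun beta :: "nat list \<Rightarrow> braid" where
  "beta [] = \<one>\<^bsub>B3\<^esub>"
| "beta [a] = \<one>\<^bsub>B3\<^esub>"
| "beta (a # b # c) = sigma1 [^]\<^bsub>B3\<^esub> a \<otimes>\<^bsub>B3\<^esub> (sigma2 [^]\<^bsub>B3\<^esub> (- int b) \<otimes>\<^bsub>B3\<^esub> beta c)"

text \<open>The dihedral group of order 4n in normal form: the pair (i, False) is the i-th power of the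
  rotation, and (i, True) is the i-th power of the rotation times the reflection.\<close>

definition dihedral :: "nat \<Rightarrow> (int \<times> bool) monoid" where
  "dihedral n = \<lparr>carrier = {0..<2 * int n} \<times> UNIV,
     mult = (\<lambda>(i, s) (j, t). ((if s then i - j else i + j) mod (2 * int n), s \<noteq> t)),
     one = (0, False)\<rparr>"

definition dih_rho :: "int \<times> bool" where "dih_rho = (1, False)"
definition dih_tau :: "int \<times> bool" where "dih_tau = (0, True)"

definition dih_act :: "int \<times> bool \<Rightarrow> nat list \<Rightarrow> nat list" where
  "dih_act g c = rotate (nat (fst g)) (if snd g then rev c else c)"

lemma group_dihedral:
  assumes "n \<ge> 1"
  shows "group (dihedral n)"
proof (rule groupI)
  fix x y z
  show "x \<otimes>\<^bsub>dihedral n\<^esub> y \<otimes>\<^bsub>dihedral n\<^esub> z = x \<otimes>\<^bsub>dihedral n\<^esub> (y \<otimes>\<^bsub>dihedral n\<^esub> z)"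
    by (cases x; cases y; cases z) (auto simp: dihedral_def mod_simps algebra_simps)
next
  fix x assume x: "x \<in> carrier (dihedral n)"
  then obtain i s where i: "x = (i, s)" "0 \<le> i" "i < 2 * int n"
    by (auto simp: dihedral_def)
  show "\<one>\<^bsub>dihedral n\<^esub> \<otimes>\<^bsub>dihedral n\<^esub> x = x"
    using i by (simp add: dihedral_def)
  show "\<exists>y\<in>carrier (dihedral n). y \<otimes>\<^bsub>dihedral n\<^esub> x = \<one>\<^bsub>dihedral n\<^esub>"
    by (rule bexI[of _ "(if s then i else (- i) mod (2 * int n), s)"])
      (use i assms in \<open>auto simp: dihedral_def mod_simps\<close>)
qed (use assms in \<open>auto simp: dihedral_def split: prod.splits\<close>)

lemma order_dihedral: "order (dihedral n) = 4 * n"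
  by (simp add: order_def dihedral_def card_cartesian_product)

lemma dihedral_relations:
  assumes "n \<ge> 1"
  shows "dih_rho [^]\<^bsub>dihedral n\<^esub> (2 * n) = \<one>\<^bsub>dihedral n\<^esub>"
    and "dih_tau [^]\<^bsub>dihedral n\<^esub> (2 :: nat) = \<one>\<^bsub>dihedral n\<^esub>"
    and "dih_tau \<otimes>\<^bsub>dihedral n\<^esub> dih_rho \<otimes>\<^bsub>dihedral n\<^esub> inv\<^bsub>dihedral n\<^esub> dih_tau
         = inv\<^bsub>dihedral n\<^esub> dih_rho"
    and "(i, s) \<in> carrier (dihedral n) \<Longrightarrow>
         (i, s) = dih_rho [^]\<^bsub>dihedral n\<^esub> nat i \<otimes>\<^bsub>dihedral n\<^esub> (if s then dih_tau else \<one>\<^bsub>dihedral n\<^esub>)"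
proof -
  interpret D: group "dihedral n" by (rule group_dihedral[OF assms])
  have r: "dih_rho \<in> carrier (dihedral n)" and t: "dih_tau \<in> carrier (dihedral n)"
    using assms by (auto simp: dihedral_def dih_rho_def dih_tau_def)
  have pow: "dih_rho [^]\<^bsub>dihedral n\<^esub> k = (int k mod (2 * int n), False)" for k :: nat
    by (induction k) (auto simp: dihedral_def dih_rho_def mod_simps algebra_simps)
  show "dih_rho [^]\<^bsub>dihedral n\<^esub> (2 * n) = \<one>\<^bsub>dihedral n\<^esub>"
    unfolding pow by (simp add: dihedral_def)
  have tt: "dih_tau \<otimes>\<^bsub>dihedral n\<^esub> dih_tau = \<one>\<^bsub>dihedral n\<^esub>"
    by (simp add: dihedral_def dih_tau_def)
  then show "dih_tau [^]\<^bsub>dihedral n\<^esub> (2 :: nat) = \<one>\<^bsub>dihedral n\<^esub>"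
    using t by (simp add: numeral_2_eq_2)
  have it: "inv\<^bsub>dihedral n\<^esub> dih_tau = dih_tau" using D.inv_equality[OF tt t t] .
  have "dih_tau \<otimes>\<^bsub>dihedral n\<^esub> dih_rho \<otimes>\<^bsub>dihedral n\<^esub> dih_tau \<otimes>\<^bsub>dihedral n\<^esub> dih_rho
        = \<one>\<^bsub>dihedral n\<^esub>"
    by (simp add: dihedral_def dih_tau_def dih_rho_def mod_simps)
  then show "dih_tau \<otimes>\<^bsub>dihedral n\<^esub> dih_rho \<otimes>\<^bsub>dihedral n\<^esub> inv\<^bsub>dihedral n\<^esub> dih_tau
         = inv\<^bsub>dihedral n\<^esub> dih_rho"
    unfolding it using D.inv_equality r t D.m_closed by metis
  show "(i, s) = dih_rho [^]\<^bsub>dihedral n\<^esub> nat i \<otimes>\<^bsub>dihedral n\<^esub> (if s then dih_tau else \<one>\<^bsub>dihedral n\<^esub>)"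
    if "(i, s) \<in> carrier (dihedral n)"
    unfolding pow using that by (auto simp: dihedral_def dih_tau_def)
qed

lemma dih_act_generators: "dih_act dih_rho c = rotate1 c" "dih_act dih_tau c = rev c"
  by (simp_all add: dih_act_def dih_rho_def dih_tau_def)

lemma dih_act_one: "dih_act \<one>\<^bsub>dihedral n\<^esub> c = c"
  by (simp add: dih_act_def dihedral_def)

lemma dih_act_mult:
  assumes "g \<in> carrier (dihedral n)" "h \<in> carrier (dihedral n)" "length c = 2 * n"
  shows "dih_act (g \<otimes>\<^bsub>dihedral n\<^esub> h) c = dih_act g (dih_act h c)"
proof -
  obtain i s j t where g: "g = (i, s)" "0 \<le> i" "i < 2 * int n"
    and h: "h = (j, t)" "0 \<le> j" "j < 2 * int n"
    using assms by (auto simp: dihedral_def)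
  have len: "length (if t then rev c else c) = 2 * n" using assms by simp
  have red: "rotate (nat (k mod (2 * int n))) d = rotate (nat k) d"
    if "length d = 2 * n" "k \<ge> 0" for k and d :: "nat list"
  proof -
    have "nat (k mod (2 * int n)) = nat k mod length d"
      using that by (simp add: nat_mod_distrib nat_mult_distrib)
    then show ?thesis by (metis rotate_conv_mod)
  qed
  show ?thesis
  proof (cases s)
    case False
    then show ?thesis using g h assms(3) red[OF len, of "i + j"]
      by (simp add: dih_act_def dihedral_def rotate_rotate nat_add_distrib)
  next
    case True
    have "rotate (nat ((i - j) mod (2 * int n))) (rev d) = rotate (nat i) (rev (rotate (nat j) d))"
      if d: "length d = 2 * n" for d :: "nat list"
    proof (cases "j = 0")
      case True
      then show ?thesis using red[of "rev d" i] d g by simp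
    next
      case False
      have n: "n \<ge> 1" using g by auto
      have "rev (rotate (nat j) d) = rotate (2 * n - nat j) (rev d)"
      proof -
        have "rotate (2 * n - nat j) (rev d) = rev (rotate (length d - (2 * n - nat j) mod length d) d)"
          by (simp add: rotate_rev)
        also have "length d - (2 * n - nat j) mod length d = nat j"
          using d h False by auto
        finally show ?thesis by simp
      qed
      then have "rotate (nat i) (rev (rotate (nat j) d)) = rotate (nat (i - j + 2 * int n)) (rev d)"
      proof -
        have "nat i + (2 * n - nat j) = nat (i - j + 2 * int n)" using g h by linarith
        then show ?thesis using \<open>rev (rotate (nat j) d) = _\<close> by (simp add: rotate_rotate)
      qed
      also have "\<dots> = rotate (nat ((i - j) mod (2 * int n))) (rev d)"
        using red[of "rev d" "i - j + 2 * int n"] d g h by simp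
      finally show ?thesis by simp
    qed
    from this[OF len] show ?thesis using g h True by (auto simp: dih_act_def dihedral_def)
  qed
qed


section \<open>Oriented links in the 3-sphere\<close>

type_synonym curve = "real \<Rightarrow> complex \<times> complex"

definition S3 :: "(complex \<times> complex) set" where
  "S3 = sphere 0 1"

text \<open>Loops are parametrized by the real line with period 1. An oriented knot is the set of all
  parametrizations, compatible with its orientation, of an oriented simple closed curve. An oriented
  link is the finite set of its components, which are pairwise disjoint oriented knots. Wild links are
  not excluded; closed braids are tame, and so is every link isotopic to one.\<close>

definition simple_loop :: "curve \<Rightarrow> bool" where
  "simple_loop \<gamma> \<longleftrightarrow>
     continuous_on UNIV \<gamma> \<and> range \<gamma> \<subseteq> S3 \<and> (\<forall>s t. \<gamma> s = \<gamma> t \<longleftrightarrow> s - t \<in> \<int>)"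

definition circle_reparam :: "(real \<Rightarrow> real) \<Rightarrow> bool" where
  "circle_reparam f \<longleftrightarrow> continuous_on UNIV f \<and> strict_mono f \<and> (\<forall>t. f (t + 1) = f t + 1)"

definition oriented_knot :: "curve \<Rightarrow> curve set" where
  "oriented_knot \<gamma> = {\<gamma> \<circ> f | f. circle_reparam f}"

definition knot_points :: "curve set \<Rightarrow> (complex \<times> complex) set" where
  "knot_points K = (\<Union>\<gamma>\<in>K. range \<gamma>)"

definition is_link :: "curve set set \<Rightarrow> bool" where
  "is_link L \<longleftrightarrow> finite L \<and> (\<forall>K\<in>L. \<exists>\<gamma>. simple_loop \<gamma> \<and> K = oriented_knot \<gamma>) \<and>
     pairwise (\<lambda>K K'. knot_points K \<inter> knot_points K' = {}) L"

typedef olink = "{L. is_link L}"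
  by (rule exI[of _ "{}"]) (simp add: is_link_def)

setup_lifting type_definition_olink

lemma circle_reparam_id: "circle_reparam id" "circle_reparam (\<lambda>t. t)"
  by (auto simp: circle_reparam_def strict_mono_def)

lemma circle_reparam_comp: "circle_reparam f \<Longrightarrow> circle_reparam g \<Longrightarrow> circle_reparam (f \<circ> g)"
  by (auto simp: circle_reparam_def strict_mono_def intro: continuous_on_compose2[where t = UNIV])

lemma real_strict_mono_inverse:
  fixes f :: "real \<Rightarrow> real"
  assumes "continuous_on UNIV f" "strict_mono f" "\<And>t. f (t + 1) = f t + c" "c > 0"
  obtains g where "continuous_on UNIV g" "strict_mono g" "\<And>x. f (g x) = x" "\<And>x. g (f x) = x"
proof -
  have shift: "f (t + of_int k) = f t + of_int k * c" for t k
  proof (induction k rule: int_induct[where k = 0])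
    case base
    show ?case by simp
  next
    case (step1 i)
    show ?case using assms(3)[of "t + of_int i"] step1 by (simp add: algebra_simps)
  next
    case (step2 i)
    show ?case using assms(3)[of "t + of_int i - 1"] step2 by (simp add: algebra_simps)
  qed
  have surj: "\<exists>t. f t = y" for y
  proof -
    define k where "k = \<lfloor>(y - f 0) / c\<rfloor>"
    have "of_int k \<le> (y - f 0) / c" "(y - f 0) / c \<le> of_int k + 1"
      unfolding k_def by linarith+
    then have "of_int k * c \<le> y - f 0" "y - f 0 \<le> (of_int k + 1) * c"
      using assms(4) by (simp_all add: field_simps)
    then have "f (of_int k) \<le> y" "y \<le> f (of_int k + 1)"
      using shift[of 0 k] assms(3)[of "of_int k"] by (simp_all add: algebra_simps)
    then have "\<exists>x\<ge>of_int k. x \<le> of_int k + 1 \<and> f x = y"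
      by (intro IVT') (use assms(1) continuous_on_subset in auto)
    then show ?thesis by blast
  qed
  have inj: "inj f" using assms(2) by (rule strict_mono_imp_inj_on)
  obtain g where g: "homeomorphism UNIV (f ` UNIV) f g"
    using injective_into_1d_eq_homeomorphism[OF assms(1)] inj by auto
  have fU: "f ` UNIV = UNIV" using surj by (metis surjI UNIV_I image_eqI subsetI subset_antisym top_greatest)
  show thesis
  proof
    show "continuous_on UNIV g" using g fU by (simp add: homeomorphism_def)
    show fg: "f (g x) = x" and "g (f x) = x" for x using g fU by (auto simp: homeomorphism_def)
    show "strict_mono g"
      unfolding strict_mono_def using fg assms(2) by (metis strict_mono_less)
  qed
qed

lemma circle_reparam_inverse:
  assumes "circle_reparam f"
  obtains g where "circle_reparam g" "f \<circ> g = id" "g \<circ> f = id"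
proof -
  obtain g where g: "continuous_on UNIV g" "strict_mono g" "\<And>x. f (g x) = x" "\<And>x. g (f x) = x"
    using real_strict_mono_inverse[of f 1] assms by (auto simp: circle_reparam_def)
  have "g (x + 1) = g x + 1" for x
    using assms g(3,4) by (metis circle_reparam_def)
  with g have "circle_reparam g" "f \<circ> g = id" "g \<circ> f = id" by (auto simp: circle_reparam_def)
  then show thesis by (rule that)
qed

lemma oriented_knot_reparam:
  assumes "circle_reparam f"
  shows "oriented_knot (\<gamma> \<circ> f) = oriented_knot \<gamma>"
proof
  show "oriented_knot (\<gamma> \<circ> f) \<subseteq> oriented_knot \<gamma>"
    using assms circle_reparam_comp by (fastforce simp: oriented_knot_def comp_assoc)
  obtain g where g: "circle_reparam g" "f \<circ> g = id" using assms by (rule circle_reparam_inverse)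
  have "\<gamma> \<circ> h = \<gamma> \<circ> f \<circ> (g \<circ> h)" for h :: "real \<Rightarrow> real"
    using g(2) by (metis comp_assoc comp_id)
  then show "oriented_knot \<gamma> \<subseteq> oriented_knot (\<gamma> \<circ> f)"
    using g(1) circle_reparam_comp unfolding oriented_knot_def by blast
qed

lemma knot_points_oriented_knot: "knot_points (oriented_knot \<gamma>) = range \<gamma>"
proof
  show "knot_points (oriented_knot \<gamma>) \<subseteq> range \<gamma>"
    by (auto simp: knot_points_def oriented_knot_def)
  show "range \<gamma> \<subseteq> knot_points (oriented_knot \<gamma>)"
    using circle_reparam_id(1) unfolding knot_points_def oriented_knot_def
    by (force intro!: exI[of _ id])
qed

text \<open>The image of an oriented link under a map of the 3-sphere, and the same link with the
  orientation of every component reversed.\<close>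

definition map_link :: "(complex \<times> complex \<Rightarrow> complex \<times> complex) \<Rightarrow> curve set set \<Rightarrow> curve set set" where
  "map_link h L = (\<lambda>K. (\<lambda>\<gamma>. h \<circ> \<gamma>) ` K) ` L"

definition reverse_link :: "curve set set \<Rightarrow> curve set set" where
  "reverse_link L = (\<lambda>K. (\<lambda>\<gamma> t. \<gamma> (- t)) ` K) ` L"

lemma map_oriented_knot: "(\<lambda>\<gamma>. h \<circ> \<gamma>) ` oriented_knot \<gamma> = oriented_knot (h \<circ> \<gamma>)"
  by (auto simp: oriented_knot_def comp_assoc image_iff)

lemma reverse_oriented_knot:
  "(\<lambda>\<gamma> t. \<gamma> (- t)) ` oriented_knot \<gamma> = oriented_knot (\<lambda>t. \<gamma> (- t))"
proof -
  have r: "circle_reparam (\<lambda>t. - f (- t))" if f: "circle_reparam f" for f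
  proof -
    have "continuous_on UNIV (\<lambda>t. - f (- t))"
    proof (rule continuous_on_minus)
      have "continuous_on UNIV f" using f by (simp add: circle_reparam_def)
      then show "continuous_on UNIV (\<lambda>t. f (- t))"
        by (rule continuous_on_compose2) (auto intro!: continuous_intros)
    qed
    moreover have "- f (- (t + 1)) = - f (- t) + 1" for t
    proof -
      have "f (- (t + 1) + 1) = f (- (t + 1)) + 1" using f by (simp only: circle_reparam_def)
      then show ?thesis by simp
    qed
    moreover have "strict_mono (\<lambda>t. - f (- t))"
      using f by (simp add: circle_reparam_def strict_mono_def)
    ultimately show ?thesis unfolding circle_reparam_def by blast
  qed
  show ?thesis
  proof (intro subset_antisym subsetI)
    fix \<delta> assume "\<delta> \<in> (\<lambda>\<gamma> t. \<gamma> (- t)) ` oriented_knot \<gamma>"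
    then obtain f where f: "circle_reparam f" "\<delta> = (\<lambda>t. \<gamma> (f (- t)))"
      by (auto simp: oriented_knot_def)
    then have "\<delta> = (\<lambda>t. \<gamma> (- t)) \<circ> (\<lambda>t. - f (- t))" by auto
    then show "\<delta> \<in> oriented_knot (\<lambda>t. \<gamma> (- t))" unfolding oriented_knot_def using r[OF f(1)] by blast
  next
    fix \<delta> assume "\<delta> \<in> oriented_knot (\<lambda>t. \<gamma> (- t))"
    then obtain f where f: "circle_reparam f" "\<delta> = (\<lambda>t. \<gamma> (- f t))"
      unfolding oriented_knot_def comp_def by blast
    then have "\<delta> = (\<lambda>\<gamma> t. \<gamma> (- t)) (\<gamma> \<circ> (\<lambda>t. - f (- t)))" by auto
    moreover have "\<gamma> \<circ> (\<lambda>t. - f (- t)) \<in> oriented_knot \<gamma>"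
      unfolding oriented_knot_def using r[OF f(1)] by blast
    ultimately show "\<delta> \<in> (\<lambda>\<gamma> t. \<gamma> (- t)) ` oriented_knot \<gamma>" by (rule image_eqI)
  qed
qed

lemma simple_loop_map:
  assumes "simple_loop \<gamma>" "continuous_on S3 h" "h ` S3 \<subseteq> S3" "inj_on h S3"
  shows "simple_loop (h \<circ> \<gamma>)"
proof -
  have r: "\<gamma> t \<in> S3" for t using assms(1) by (auto simp: simple_loop_def)
  have "continuous_on UNIV (h \<circ> \<gamma>)"
  proof (rule continuous_on_compose)
    show "continuous_on UNIV \<gamma>" using assms(1) by (simp add: simple_loop_def)
    show "continuous_on (range \<gamma>) h"
      by (rule continuous_on_subset[OF assms(2)]) (use r in auto)
  qed
  moreover have "h (\<gamma> s) = h (\<gamma> t) \<longleftrightarrow> \<gamma> s = \<gamma> t" for s t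
    using r assms(4) by (auto simp: inj_on_def)
  ultimately show ?thesis
    using assms(1,3) r unfolding simple_loop_def by (simp add: image_subset_iff)
qed

lemma simple_loop_reverse: "simple_loop \<gamma> \<Longrightarrow> simple_loop (\<lambda>t. \<gamma> (- t))"
proof -
  assume g: "simple_loop \<gamma>"
  have "continuous_on UNIV (\<lambda>t. \<gamma> (- t))"
  proof -
    have "continuous_on UNIV \<gamma>" using g by (simp add: simple_loop_def)
    then show ?thesis
      by (rule continuous_on_compose2) (auto intro!: continuous_intros)
  qed
  moreover have "- s - - t \<in> \<int> \<longleftrightarrow> s - t \<in> \<int>" for s t :: real
  proof -
    have "- s - - t = - (s - t)" by simp
    then show ?thesis by (metis Ints_minus minus_minus)
  qed
  moreover have "\<gamma> (- t) \<in> S3" for t using g by (auto simp: simple_loop_def)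
  ultimately show "simple_loop (\<lambda>t. \<gamma> (- t))"
    using g by (simp add: simple_loop_def image_subset_iff)
qed

lemma is_link_map:
  assumes "is_link L" "continuous_on S3 h" "h ` S3 \<subseteq> S3" "inj_on h S3"
  shows "is_link (map_link h L)"
  unfolding is_link_def
proof (intro conjI ballI)
  show "finite (map_link h L)" using assms(1) by (simp add: is_link_def map_link_def)
next
  fix K assume "K \<in> map_link h L"
  then obtain J where J: "J \<in> L" "K = (\<lambda>\<gamma>. h \<circ> \<gamma>) ` J" by (auto simp: map_link_def)
  then obtain \<gamma> where "simple_loop \<gamma>" "J = oriented_knot \<gamma>" using assms(1) by (meson is_link_def)
  with J have "simple_loop \<gamma>" "K = oriented_knot (h \<circ> \<gamma>)" by (simp_all add: map_oriented_knot)
  then show "\<exists>\<gamma>. simple_loop \<gamma> \<and> K = oriented_knot \<gamma>"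
    using simple_loop_map assms(2-4) by blast
next
  show "pairwise (\<lambda>K K'. knot_points K \<inter> knot_points K' = {}) (map_link h L)"
  proof (rule pairwiseI)
    fix K K' assume "K \<in> map_link h L" "K' \<in> map_link h L" and ne: "K \<noteq> K'"
    then obtain J J' where J: "J \<in> L" "K = (\<lambda>\<gamma>. h \<circ> \<gamma>) ` J"
      and J': "J' \<in> L" "K' = (\<lambda>\<gamma>. h \<circ> \<gamma>) ` J'" by (auto simp: map_link_def)
    obtain \<gamma> \<gamma>' where g: "simple_loop \<gamma>" "J = oriented_knot \<gamma>" "simple_loop \<gamma>'" "J' = oriented_knot \<gamma>'"
      using assms(1) J J' by (meson is_link_def)
    have "range \<gamma> \<inter> range \<gamma>' = {}"
    proof -
      have "J \<noteq> J'" using ne J J' by auto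
      then have "knot_points J \<inter> knot_points J' = {}"
        using assms(1) J(1) J'(1) by (simp add: is_link_def pairwise_def)
      then show ?thesis by (simp add: g knot_points_oriented_knot)
    qed
    moreover have "range \<gamma> \<subseteq> S3" "range \<gamma>' \<subseteq> S3" using g by (auto simp: simple_loop_def)
    ultimately have "range (h \<circ> \<gamma>) \<inter> range (h \<circ> \<gamma>') = {}"
    proof -
      have *: False if "h (\<gamma> s) = h (\<gamma>' t)" for s t
        using that assms(4) \<open>range \<gamma> \<inter> range \<gamma>' = {}\<close> \<open>range \<gamma> \<subseteq> S3\<close> \<open>range \<gamma>' \<subseteq> S3\<close>
        by (metis disjoint_iff inj_onD range_subsetD rangeI)
      show ?thesis
      proof (rule equals0I)
        fix x assume "x \<in> range (h \<circ> \<gamma>) \<inter> range (h \<circ> \<gamma>')"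
        then have "\<exists>s. x = h (\<gamma> s)" "\<exists>t. x = h (\<gamma>' t)" by auto
        then obtain s t where "x = h (\<gamma> s)" "x = h (\<gamma>' t)" by blast
        with *[of s t] show False by simp
      qed
    qed
    then show "knot_points K \<inter> knot_points K' = {}"
      using g J J' by (simp add: map_oriented_knot knot_points_oriented_knot)
  qed
qed

lemma is_link_reverse:
  assumes "is_link L"
  shows "is_link (reverse_link L)"
  unfolding is_link_def
proof (intro conjI ballI)
  show "finite (reverse_link L)" using assms(1) by (simp add: is_link_def reverse_link_def)
next
  fix K assume "K \<in> reverse_link L"
  then obtain J where J: "J \<in> L" "K = (\<lambda>\<gamma> t. \<gamma> (- t)) ` J" by (auto simp: reverse_link_def)
  then obtain \<gamma> where "simple_loop \<gamma>" "J = oriented_knot \<gamma>" using assms(1) by (meson is_link_def)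
  with J have "simple_loop \<gamma>" "K = oriented_knot (\<lambda>t. \<gamma> (- t))" by (simp_all add: reverse_oriented_knot)
  then show "\<exists>\<gamma>. simple_loop \<gamma> \<and> K = oriented_knot \<gamma>"
    using simple_loop_reverse by blast
next
  have pts: "knot_points ((\<lambda>\<gamma> t. \<gamma> (- t)) ` K) = knot_points K" for K
  proof -
    have "range (\<lambda>t. \<gamma> (- t)) = range \<gamma>" for \<gamma> :: curve
    proof -
      have "range (\<lambda>t. \<gamma> (- t)) = \<gamma> ` range uminus" by (simp only: image_image)
      then show ?thesis by simp
    qed
    then show ?thesis by (simp add: knot_points_def)
  qed
  show "pairwise (\<lambda>K K'. knot_points K \<inter> knot_points K' = {}) (reverse_link L)"
    using assms unfolding is_link_def reverse_link_def pairwise_image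
    by (auto simp: pairwise_def pts)
qed

definition reflection :: "complex \<times> complex \<Rightarrow> complex \<times> complex" where
  "reflection x = (fst x, cnj (snd x))"

lemma reflection_S3: "reflection ` S3 \<subseteq> S3" "continuous_on S3 reflection" "inj_on reflection S3"
  by (auto simp: reflection_def S3_def norm_prod_def inj_on_def prod_eq_iff intro!: continuous_intros)

text \<open>\<open>mirror\<close> uses an orientation-reversing isometry of the 3-sphere. With respect to the projection that
  takes the real part of the second coordinate (in which closed braids are drawn) it flips every
  crossing.\<close>

lift_definition mirror :: "olink \<Rightarrow> olink" is "map_link reflection"
  by (rule is_link_map) (use reflection_S3 in auto)

lift_definition reverse :: "olink \<Rightarrow> olink" is reverse_link
  by (rule is_link_reverse)

definition ambient_isotopy :: "(real \<Rightarrow> complex \<times> complex \<Rightarrow> complex \<times> complex) \<Rightarrow> bool" where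
  "ambient_isotopy H \<longleftrightarrow> continuous_on ({0..1} \<times> S3) (\<lambda>(t, x). H t x) \<and>
     (\<forall>t\<in>{0..1}. \<exists>g. homeomorphism S3 S3 (H t) g) \<and> (\<forall>x\<in>S3. H 0 x = x)"

lift_definition isotopic :: "olink \<Rightarrow> olink \<Rightarrow> bool" is
  "\<lambda>L L'. \<exists>H. ambient_isotopy H \<and> L' = map_link (H 1) L" .

lemma cis_eqD:
  assumes "cis a = cis b"
  obtains k :: int where "a = b + 2 * pi * of_int k"
proof -
  have "cis (a - b) = 1" using assms by (metis cis_divide divide_self_if cis_neq_zero)
  then have "cos (a - b) = 1" by (metis cis.sel(1) one_complex.sel(1))
  then obtain k :: int where "a - b = of_int k * 2 * pi" by (auto simp: cos_one_2pi_int)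
  then have "a = b + 2 * pi * of_int k" by (simp add: algebra_simps)
  then show thesis by (rule that)
qed

text \<open>The operation group, acting on oriented links; it acts on link types (isotopy classes) by images.\<close>

definition link_ops :: "(olink \<Rightarrow> olink) monoid" where
  "link_ops = \<lparr>carrier = {id, mirror, reverse, mirror \<circ> reverse}, mult = (\<circ>), one = id\<rparr>"

lemma mirror_mirror: "mirror \<circ> mirror = id"
proof
  fix L show "(mirror \<circ> mirror) L = id L"
    by (simp, transfer) (simp add: map_link_def image_image comp_def reflection_def)
qed

lemma reverse_reverse: "reverse \<circ> reverse = id"
proof
  fix L show "(reverse \<circ> reverse) L = id L"
    by (simp, transfer) (simp add: reverse_link_def image_image)
qed

lemma mirror_reverse: "mirror \<circ> reverse = reverse \<circ> mirror"
proof
  fix L show "(mirror \<circ> reverse) L = (reverse \<circ> mirror) L"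
    by (simp, transfer) (simp add: reverse_link_def map_link_def image_image comp_def)
qed

lemma group_link_ops: "group link_ops"
proof (rule groupI)
  show "\<exists>y\<in>carrier link_ops. y \<otimes>\<^bsub>link_ops\<^esub> x = \<one>\<^bsub>link_ops\<^esub>" if "x \<in> carrier link_ops" for x
    using that mirror_mirror reverse_reverse mirror_reverse
    by (intro bexI[of _ x]) (auto simp: link_ops_def fun_eq_iff)
qed (use mirror_mirror reverse_reverse mirror_reverse in \<open>auto simp: link_ops_def fun_eq_iff\<close>)

lemma order_link_ops: "order link_ops = 4"
proof -
  define \<gamma> :: curve where "\<gamma> t = (of_real (4 / 5) * cis (2 * pi * t), of_real (3 / 5) * \<i>)" for t
  have eq: "\<gamma> s = \<gamma> t \<longleftrightarrow> s - t \<in> \<int>" for s t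
  proof
    assume "\<gamma> s = \<gamma> t"
    then have "cis (2 * pi * s) = cis (2 * pi * t)" by (simp add: \<gamma>_def)
    then obtain k :: int where "2 * pi * s = 2 * pi * t + 2 * pi * of_int k" by (rule cis_eqD)
    then have "2 * pi * (s - t) = 2 * pi * of_int k" by (simp add: algebra_simps)
    then show "s - t \<in> \<int>" by simp
  next
    assume "s - t \<in> \<int>"
    then have "cis (2 * pi * t + 2 * pi * (s - t)) = cis (2 * pi * t)"
      by (simp only: cis_mult[symmetric] cis_multiple_2pi mult_1_right)
    then have "cis (2 * pi * s) = cis (2 * pi * t)" by (simp add: algebra_simps)
    then show "\<gamma> s = \<gamma> t" by (simp add: \<gamma>_def)
  qed
  have "\<gamma> t \<in> S3" for t
    by (simp add: \<gamma>_def S3_def norm_prod_def norm_mult power2_eq_square)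
  moreover have "continuous_on UNIV \<gamma>" unfolding \<gamma>_def by (intro continuous_intros)
  ultimately have "simple_loop \<gamma>" using eq by (simp add: simple_loop_def image_subset_iff)
  then have "is_link {oriented_knot \<gamma>}" by (auto simp: is_link_def)
  then obtain L where L: "Rep_olink L = {oriented_knot \<gamma>}" by (metis Abs_olink_inverse mem_Collect_eq)
  have m: "Rep_olink (mirror L) = {oriented_knot (reflection \<circ> \<gamma>)}"
    by (simp add: mirror.rep_eq L map_link_def map_oriented_knot)
  have r: "Rep_olink (reverse L) = {oriented_knot (\<lambda>t. \<gamma> (- t))}"
    by (simp add: reverse.rep_eq L reverse_link_def reverse_oriented_knot)
  have ptm: "knot_points (oriented_knot (reflection \<circ> \<gamma>)) \<noteq> knot_points (oriented_knot \<delta>)"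
    if "\<And>t. snd (\<delta> t) = of_real (3 / 5) * \<i>" for \<delta>
  proof
    assume "knot_points (oriented_knot (reflection \<circ> \<gamma>)) = knot_points (oriented_knot \<delta>)"
    then have "(reflection \<circ> \<gamma>) 0 \<in> range \<delta>" unfolding knot_points_oriented_knot by blast
    then obtain t where "reflection (\<gamma> 0) = \<delta> t" by auto
    then have "snd (reflection (\<gamma> 0)) = of_real (3 / 5) * \<i>" using that by simp
    then show False by (simp add: reflection_def \<gamma>_def complex_eq_iff)
  qed
  have 1: "mirror \<noteq> id"
    using ptm[of \<gamma>] m L by (auto simp: \<gamma>_def)
  have 2: "mirror \<noteq> reverse"
    using ptm[of "\<lambda>t. \<gamma> (- t)"] m r by (auto simp: \<gamma>_def)
  have 3: "reverse \<noteq> id"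
  proof
    assume "reverse = id"
    then have "oriented_knot (\<lambda>t. \<gamma> (- t)) = oriented_knot \<gamma>" using r L by simp
    moreover have "(\<lambda>t. \<gamma> (- t)) \<in> oriented_knot (\<lambda>t. \<gamma> (- t))"
      unfolding oriented_knot_def using circle_reparam_id(1) by (intro CollectI exI[of _ id]) simp
    ultimately obtain f where f: "circle_reparam f" "(\<lambda>t. \<gamma> (- t)) = \<gamma> \<circ> f"
      unfolding oriented_knot_def by blast
    have "\<gamma> (f t) = \<gamma> (- t)" for t using f(2) by (metis comp_apply)
    then have int: "f t + t \<in> \<int>" for t using eq[of "f t" "- t"] by simp
    have cont: "continuous_on {0..1} (\<lambda>t. f t + t)"
      using f(1) unfolding circle_reparam_def
      by (intro continuous_on_add continuous_on_id) (auto intro: continuous_on_subset)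
    have "f 1 = f 0 + 1" using f(1) unfolding circle_reparam_def by (metis add_0)
    then have "\<exists>x\<ge>0. x \<le> 1 \<and> f x + x = f 0 + 1 / 2"
      by (intro IVT' cont) auto
    then obtain x where "f x + x = f 0 + 1 / 2" by blast
    then have "(1 / 2 :: real) \<in> \<int>" using int[of x] int[of 0] by (metis Ints_diff add.right_neutral add_diff_cancel_left')
    then show False by (auto elim!: Ints_cases)
  qed
  have "mirror \<circ> (mirror \<circ> reverse) = reverse" "mirror \<circ> reverse \<circ> reverse = mirror"
    using mirror_mirror reverse_reverse by (simp_all add: comp_assoc flip: comp_assoc[of mirror mirror])
  then have "mirror \<circ> reverse \<noteq> id" "mirror \<circ> reverse \<noteq> mirror" "mirror \<circ> reverse \<noteq> reverse"
    using 1 2 3 mirror_mirror reverse_reverse by (metis comp_id id_comp)+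
  then show ?thesis
    using 1 2 3 by (simp add: order_def link_ops_def)
qed

section \<open>Closed braids\<close>

text \<open>A braid is a motion of three points in the unit disc which start and end at -1/2, 0, 1/2. The letter
  for a generator exchanges two neighbouring points by a counterclockwise half twist about their
  midpoint; the inverse letter twists clockwise. Choosing the opposite twist would replace every
  closure by its mirror image.\<close>

definition strand_base :: "complex set" where
  "strand_base = {- 1 / 2, 0, 1 / 2}"

fun twist_centre :: "braid_gen \<Rightarrow> complex" where
  "twist_centre Sigma1 = - 1 / 4"
| "twist_centre Sigma2 = 1 / 4"

definition half_twist :: "braid_gen \<times> bool \<Rightarrow> real \<Rightarrow> complex \<Rightarrow> complex" where
  "half_twist l s p = (let z = twist_centre (fst l) in
     if cmod (p - z) = 1 / 4 then z + cis (if snd l then pi * s else - (pi * s)) * (p - z) else p)"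

text \<open>The positions of the strands at time t, for 0 \<le> t < 1: the letters of w are performed one after
  the other, each in time 1 / length w.\<close>

definition strands_at :: "braid_word \<Rightarrow> real \<Rightarrow> complex set" where
  "strands_at w t = (if w = [] then strand_base
     else half_twist (w ! nat \<lfloor>t * real (length w)\<rfloor>) (frac (t * real (length w))) ` strand_base)"

text \<open>The closed braid lies in the solid torus of all points of the 3-sphere with nonzero first coordinate.
  It is oriented such that the argument of the first coordinate increases.\<close>

definition closed_braid_points :: "braid_word \<Rightarrow> (complex \<times> complex) set" where
  "closed_braid_points w =
     {(of_real (sqrt (1 - (cmod q)\<^sup>2)) * cis (2 * pi * t), q) | t q. 0 \<le> t \<and> t < 1 \<and> q \<in> strands_at w t}"

definition winds_positively :: "curve \<Rightarrow> bool" where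
  "winds_positively \<gamma> \<longleftrightarrow> (\<exists>\<phi>. continuous_on UNIV \<phi> \<and> strict_mono \<phi> \<and>
     (\<forall>t. fst (\<gamma> t) = of_real (cmod (fst (\<gamma> t))) * cis (\<phi> t)))"

definition closed_braid_components :: "braid_word \<Rightarrow> curve set set" where
  "closed_braid_components w =
     {oriented_knot \<gamma> | \<gamma>. simple_loop \<gamma> \<and> range \<gamma> \<subseteq> closed_braid_points w \<and> winds_positively \<gamma>}"

lemma half_twist_image:
  obtains u where "cmod u = 1" "half_twist l s ` strand_base =
    (case fst l of Sigma1 \<Rightarrow> {- 1 / 4 - u / 4, - 1 / 4 + u / 4, 1 / 2}
     | Sigma2 \<Rightarrow> {- 1 / 2, 1 / 4 - u / 4, 1 / 4 + u / 4})"
proof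
  let ?u = "cis (if snd l then pi * s else - (pi * s))"
  show "cmod ?u = 1" by simp
  have n: "cmod (- (1/2) - 1/4) = 3/4" "cmod (1/2 + 1/4) = 3/4" "cmod (- (1/2) + 1/4) = 1/4"
    "cmod (1/2 - 1/4) = 1/4" by (simp_all add: cmod_def)
  show "half_twist l s ` strand_base =
    (case fst l of Sigma1 \<Rightarrow> {- 1 / 4 - ?u / 4, - 1 / 4 + ?u / 4, 1 / 2}
     | Sigma2 \<Rightarrow> {- 1 / 2, 1 / 4 - ?u / 4, 1 / 4 + ?u / 4})"
    using n by (cases "fst l") (auto simp: half_twist_def strand_base_def Let_def field_simps)
qed

lemma strands_at_cases:
  obtains u where "cmod u = 1" "strands_at w t = {- 1 / 4 - u / 4, - 1 / 4 + u / 4, 1 / 2}"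
  | u where "cmod u = 1" "strands_at w t = {- 1 / 2, 1 / 4 - u / 4, 1 / 4 + u / 4}"
proof (cases "w = []")
  case True
  then show thesis using that(1)[of 1] by (simp add: strands_at_def strand_base_def)
next
  case False
  show thesis
    by (rule half_twist_image[of "w ! nat \<lfloor>t * real (length w)\<rfloor>" "frac (t * real (length w))"])
      (use False that in \<open>auto simp: strands_at_def split: braid_gen.splits\<close>)
qed

lemma strands_at_finite: "finite (strands_at w t)"
  by (rule strands_at_cases[of w t]) auto

lemma strands_at_bound:
  assumes "q \<in> strands_at w t"
  shows "cmod q \<le> 1 / 2"
proof -
  have b: "cmod (a + u / 4) \<le> 1/2" "cmod (a - u / 4) \<le> 1/2" if "cmod u = 1" "cmod a = 1/4" for a u
    using that norm_triangle_ineq[of a "u/4"] norm_triangle_ineq4[of a "u/4"] by (simp_all add: norm_divide)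
  have "cmod (- 1 / 4) = 1 / 4" "cmod (1 / 4) = 1 / 4" "cmod (- 1 / 2) = 1 / 2" "cmod (1 / 2) = 1 / 2"
    by (simp_all add: norm_divide)
  note c = this
  show ?thesis
  proof (cases rule: strands_at_cases[of w t])
    case (1 u)
    then have "q = - 1 / 4 - u / 4 \<or> q = - 1 / 4 + u / 4 \<or> q = 1 / 2" using assms by blast
    then show ?thesis using b[OF 1(1) c(1)] c by (metis order_refl)
  next
    case (2 u)
    then have "q = - 1 / 2 \<or> q = 1 / 4 - u / 4 \<or> q = 1 / 4 + u / 4" using assms by blast
    then show ?thesis using b[OF 2(1) c(2)] c by (metis order_refl)
  qed
qed

lemma strands_at_sep:
  assumes "p \<in> strands_at w t" "q \<in> strands_at w t" "p \<noteq> q"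
  shows "cmod (p - q) \<ge> 1 / 2"
proof -
  have b: "cmod (a + u / 4 - c) \<ge> 1/2" "cmod (a - u / 4 - c) \<ge> 1/2"
    "cmod (c - (a + u / 4)) \<ge> 1/2" "cmod (c - (a - u / 4)) \<ge> 1/2"
    "cmod (a + u / 4 - (a - u / 4)) \<ge> 1/2" "cmod (a - u / 4 - (a + u / 4)) \<ge> 1/2"
    if "cmod u = 1" "cmod (a - c) = 3/4" for a u c
  proof -
    have n: "cmod (u / 4) = 1/4" using that by (simp add: norm_divide)
    show 1: "cmod (a + u / 4 - c) \<ge> 1/2" "cmod (a - u / 4 - c) \<ge> 1/2"
      using norm_triangle_ineq2[of "a - c" "- (u/4)"] norm_triangle_ineq2[of "a - c" "u/4"] n that
      by (simp_all add: algebra_simps)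
    then show "cmod (c - (a + u / 4)) \<ge> 1/2" "cmod (c - (a - u / 4)) \<ge> 1/2"
      by (metis norm_minus_commute)+
    have "a + u / 4 - (a - u / 4) = 2 * (u/4)" "a - u / 4 - (a + u / 4) = - (2 * (u / 4))" by simp_all
    then show "cmod (a + u / 4 - (a - u / 4)) \<ge> 1/2" "cmod (a - u / 4 - (a + u / 4)) \<ge> 1/2"
      using n by (simp_all only: norm_mult norm_minus_cancel) auto
  qed
  have "cmod (- 1 / 4 - 1 / 2) = 3/4" "cmod (1/4 - - 1/2) = 3/4" by (simp_all add: cmod_def)
  note b1 = b[OF _ this(1)] and b2 = b[OF _ this(2)]
  show ?thesis
  proof (cases rule: strands_at_cases[of w t])
    case (1 u)
    then have "p = - 1 / 4 - u / 4 \<or> p = - 1 / 4 + u / 4 \<or> p = 1 / 2"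
      "q = - 1 / 4 - u / 4 \<or> q = - 1 / 4 + u / 4 \<or> q = 1 / 2" using assms by blast+
    then show ?thesis using b1[OF 1(1)] assms(3) by metis
  next
    case (2 u)
    then have "p = - 1 / 2 \<or> p = 1 / 4 - u / 4 \<or> p = 1 / 4 + u / 4"
      "q = - 1 / 2 \<or> q = 1 / 4 - u / 4 \<or> q = 1 / 4 + u / 4" using assms by blast+
    then show ?thesis using b2[OF 2(1)] assms(3) by metis
  qed
qed

lemma closed_braid_pointD:
  assumes "x \<in> closed_braid_points w" "fst x = of_real (cmod (fst x)) * cis \<theta>"
  shows "snd x \<in> strands_at w (frac (\<theta> / (2 * pi)))"
    and "fst x = of_real (sqrt (1 - (cmod (snd x))\<^sup>2)) * cis \<theta>"
proof -
  obtain t q where x: "x = (of_real (sqrt (1 - (cmod q)\<^sup>2)) * cis (2 * pi * t), q)"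
    and t: "0 \<le> t" "t < 1" and q: "q \<in> strands_at w t"
    using assms(1) by (auto simp: closed_braid_points_def)
  have "cmod q \<le> 1/2" using q by (rule strands_at_bound)
  then have "(cmod q)\<^sup>2 \<le> (1/2)\<^sup>2" by (intro power_mono) auto
  then have pos: "sqrt (1 - (cmod q)\<^sup>2) > 0" by (simp add: power2_eq_square)
  have c: "cmod (fst x) = sqrt (1 - (cmod q)\<^sup>2)" using pos by (simp add: x norm_mult)
  then show "fst x = of_real (sqrt (1 - (cmod (snd x))\<^sup>2)) * cis \<theta>"
    using assms(2) by (simp add: x)
  have "cis \<theta> = cis (2 * pi * t)" using assms(2) c pos by (simp add: x)
  then obtain k :: int where "\<theta> = 2 * pi * t + 2 * pi * of_int k" by (rule cis_eqD)
  then have "\<theta> / (2 * pi) = t + of_int k" by (simp add: field_simps)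
  then have "frac (\<theta> / (2 * pi)) = t" using t by (simp add: frac_unique_iff)
  then show "snd x \<in> strands_at w (frac (\<theta> / (2 * pi)))" using q x by simp
qed

lemma positive_lift:
  assumes "simple_loop \<gamma>" "range \<gamma> \<subseteq> closed_braid_points w"
    and "continuous_on UNIV \<phi>" "strict_mono \<phi>"
    and lift: "\<And>t. fst (\<gamma> t) = of_real (cmod (fst (\<gamma> t))) * cis (\<phi> t)"
  obtains c where "c > 0" "\<And>t. \<phi> (t + 1) = \<phi> t + c"
proof -
  have nz: "cmod (fst (\<gamma> t)) \<noteq> 0" for t
  proof -
    obtain s q where x: "\<gamma> t = (of_real (sqrt (1 - (cmod q)\<^sup>2)) * cis (2 * pi * s), q)"
      and q: "q \<in> strands_at w s"
    proof -
      have "\<gamma> t \<in> closed_braid_points w" using assms(2) by auto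
      then show thesis using that by (auto simp: closed_braid_points_def)
    qed
    have "(cmod q)\<^sup>2 \<le> (1/2)\<^sup>2" using strands_at_bound[OF q] by (intro power_mono) auto
    then show ?thesis by (simp add: x power2_eq_square)
  qed
  define d where "d t = (\<phi> (t + 1) - \<phi> t) / (2 * pi)" for t
  have dint: "d t \<in> \<int>" for t
  proof -
    have "\<gamma> (t + 1) = \<gamma> t" using assms(1) by (simp add: simple_loop_def)
    then have "cis (\<phi> (t + 1)) = cis (\<phi> t)"
      using lift[of t] lift[of "t + 1"] nz[of t] by (metis mult_cancel_left norm_of_real of_real_0 norm_zero abs_zero of_real_eq_0_iff)
    then obtain k :: int where "\<phi> (t + 1) = \<phi> t + 2 * pi * of_int k" by (rule cis_eqD)
    then show ?thesis by (simp add: d_def)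
  qed
  have "continuous_on UNIV d"
  proof -
    have "continuous_on UNIV (\<lambda>t. \<phi> (t + 1))"
      by (rule continuous_on_compose2[OF assms(3)]) (auto intro!: continuous_intros)
    then show ?thesis unfolding d_def using assms(3) by (intro continuous_intros) auto
  qed
  moreover have "\<exists>e>0. \<forall>y. y \<in> UNIV \<and> d y \<noteq> d x \<longrightarrow> e \<le> norm (d y - d x)" for x
  proof (intro exI[of _ 1] conjI allI impI)
    fix y assume "y \<in> UNIV \<and> d y \<noteq> d x"
    moreover have "d y - d x \<in> \<int>" using dint by (intro Ints_diff)
    ultimately show "1 \<le> norm (d y - d x)" by (metis Ints_nonzero_abs_ge1 eq_iff_diff_eq_0 real_norm_def)
  qed simp
  ultimately have "d constant_on UNIV"
    by (intro continuous_discrete_range_constant) auto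
  then obtain c where c: "\<And>t. d t = c" by (auto simp: constant_on_def)
  have e: "\<phi> (t + 1) = \<phi> t + 2 * pi * c" for t using c[of t] by (simp add: d_def field_simps)
  moreover have "\<phi> 0 < \<phi> 1" using assms(4) by (simp add: strict_mono_def)
  then have "2 * pi * c > 0" using e[of 0] by simp
  ultimately show thesis using that by blast
qed

lemma positive_loops_meet:
  assumes g: "simple_loop \<gamma>" "range \<gamma> \<subseteq> closed_braid_points w" "winds_positively \<gamma>"
    and g': "simple_loop \<gamma>'" "range \<gamma>' \<subseteq> closed_braid_points w" "winds_positively \<gamma>'"
    and meet: "\<gamma> a = \<gamma>' b"
  shows "oriented_knot \<gamma> = oriented_knot \<gamma>'"
proof -
  obtain \<phi> where p: "continuous_on UNIV \<phi>" "strict_mono \<phi>"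
    "\<And>t. fst (\<gamma> t) = of_real (cmod (fst (\<gamma> t))) * cis (\<phi> t)"
    using g(3) by (auto simp: winds_positively_def)
  obtain \<psi> where q: "continuous_on UNIV \<psi>" "strict_mono \<psi>"
    "\<And>t. fst (\<gamma>' t) = of_real (cmod (fst (\<gamma>' t))) * cis (\<psi> t)"
    using g'(3) by (auto simp: winds_positively_def)
  obtain c where c: "c > 0" "\<And>t. \<psi> (t + 1) = \<psi> t + c" using positive_lift[OF g'(1,2) q] by blast
  obtain iv where chi: "continuous_on UNIV iv" "strict_mono iv" "\<And>x. \<psi> (iv x) = x" "\<And>x. iv (\<psi> x) = x"
    using real_strict_mono_inverse[OF q(1,2) c(2,1)] by blast
  have sn: "snd (\<gamma> t) \<in> strands_at w (frac (\<phi> t / (2 * pi)))"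
    and fs: "fst (\<gamma> t) = of_real (sqrt (1 - (cmod (snd (\<gamma> t)))\<^sup>2)) * cis (\<phi> t)" for t
  proof -
    have "\<gamma> t \<in> closed_braid_points w" using g(2) by auto
    from closed_braid_pointD[OF this p(3)]
    show "snd (\<gamma> t) \<in> strands_at w (frac (\<phi> t / (2 * pi)))"
      and "fst (\<gamma> t) = of_real (sqrt (1 - (cmod (snd (\<gamma> t)))\<^sup>2)) * cis (\<phi> t)" .
  qed
  have sn': "snd (\<gamma>' t) \<in> strands_at w (frac (\<psi> t / (2 * pi)))"
    and fs': "fst (\<gamma>' t) = of_real (sqrt (1 - (cmod (snd (\<gamma>' t)))\<^sup>2)) * cis (\<psi> t)" for t
  proof -
    have "\<gamma>' t \<in> closed_braid_points w" using g'(2) by auto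
    from closed_braid_pointD[OF this q(3)]
    show "snd (\<gamma>' t) \<in> strands_at w (frac (\<psi> t / (2 * pi)))"
      and "fst (\<gamma>' t) = of_real (sqrt (1 - (cmod (snd (\<gamma>' t)))\<^sup>2)) * cis (\<psi> t)" .
  qed
  have "(cmod (snd (\<gamma> a)))\<^sup>2 \<le> (1/2)\<^sup>2"
    using strands_at_bound[OF sn[of a]] by (intro power_mono) auto
  then have "sqrt (1 - (cmod (snd (\<gamma> a)))\<^sup>2) \<noteq> 0" by (simp add: power2_eq_square)
  then have "cis (\<psi> b) = cis (\<phi> a)" using fs[of a] fs'[of b] meet by simp
  then obtain k :: int where k: "\<psi> b = \<phi> a + 2 * pi * of_int k" by (rule cis_eqD)
  define f where "f t = iv (\<phi> t + 2 * pi * of_int k)" for t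
  have psif: "\<psi> (f t) = \<phi> t + 2 * pi * of_int k" for t by (simp add: f_def chi)
  have fa: "f a = b" using k chi(4)[of b] by (simp add: f_def)
  have contf: "continuous_on UNIV f"
    unfolding f_def
    by (rule continuous_on_compose2[OF chi(1)]) (use p(1) in \<open>auto intro!: continuous_intros\<close>)
  have monof: "strict_mono f" using chi(2) p(2) by (auto simp: f_def strict_mono_def)
  have "\<psi> (f t) / (2 * pi) = \<phi> t / (2 * pi) + of_int k" for t by (simp add: psif field_simps)
  then have sn'': "snd (\<gamma>' (f t)) \<in> strands_at w (frac (\<phi> t / (2 * pi)))" for t
    using sn'[of "f t"] by (simp add: frac_add_of_int_right)
  define D where "D t = cmod (snd (\<gamma> t) - snd (\<gamma>' (f t)))" for t
  have "continuous_on UNIV D"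
  proof -
    have "continuous_on UNIV \<gamma>" "continuous_on UNIV \<gamma>'" using g(1) g'(1) by (auto simp: simple_loop_def)
    moreover from this(2) have "continuous_on UNIV (\<lambda>t. \<gamma>' (f t))"
      by (rule continuous_on_compose2) (use contf in auto)
    ultimately show ?thesis unfolding D_def by (intro continuous_intros) auto
  qed
  then have "connected (range D)" by (intro connected_continuous_image) auto
  moreover have "D t = 0 \<or> D t \<ge> 1/2" for t
    using strands_at_sep[OF sn[of t] sn''[of t]] by (auto simp: D_def)
  moreover have "D a = 0" using meet fa by (simp add: D_def)
  ultimately have "D t = 0" for t
  proof -
    assume conn: "connected (range D)" and dich: "\<And>t. D t = 0 \<or> D t \<ge> 1/2" and Da: "D a = 0"
    show "D t = 0"
    proof (rule ccontr)
      assume "D t \<noteq> 0"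
      then have "1/4 \<in> range D"
        using connectedD_interval[OF conn, of "D a" "D t" "1/4"] dich[of t] Da by auto
      then obtain s where "D s = 1/4" by auto
      then show False using dich[of s] by auto
    qed
  qed
  then have sneq: "snd (\<gamma> t) = snd (\<gamma>' (f t))" for t by (simp add: D_def)
  have cis_per: "cis (\<phi> t + 2 * pi * of_int k) = cis (\<phi> t)" for t
    by (simp only: cis_mult[symmetric] cis_multiple_2pi Ints_of_int mult_1_right)
  have eq: "\<gamma> t = \<gamma>' (f t)" for t
  proof (rule prod_eqI)
    show "fst (\<gamma> t) = fst (\<gamma>' (f t))"
      using fs[of t] fs'[of "f t"] sneq[of t] by (simp add: psif cis_per)
  qed (rule sneq)
  have f1: "f (t + 1) = f t + 1" for t
  proof -
    have "\<gamma>' (f (t + 1)) = \<gamma>' (f t)" using g(1) by (simp add: eq[symmetric] simple_loop_def)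
    then have "f (t + 1) - f t \<in> \<int>" using g'(1) by (simp add: simple_loop_def)
    moreover have "f (t + 1) - f t > 0" using monof by (simp add: strict_mono_def)
    ultimately have "f (t + 1) - f t \<ge> 1" using Ints_nonzero_abs_ge1 by fastforce
    then have ge1: "f t + 1 \<le> f (t + 1)" by simp
    have "\<exists>s\<ge>t. s \<le> t + 1 \<and> f s = f t + 1"
      by (intro IVT') (use ge1 contf continuous_on_subset in auto)
    then obtain s where s: "t \<le> s" "s \<le> t + 1" "f s = f t + 1" by blast
    have "\<gamma>' (f s) = \<gamma>' (f t)" using g'(1) s(3) by (simp add: simple_loop_def)
    then have "s - t \<in> \<int>" using g(1) by (simp add: eq[symmetric] simple_loop_def)
    moreover have "s \<noteq> t" using s(3) by auto
    ultimately have "\<bar>s - t\<bar> \<ge> 1" using Ints_nonzero_abs_ge1[of "s - t"] by simp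
    then have "s = t + 1" using s by simp
    then show ?thesis using s(3) by simp
  qed
  have "circle_reparam f" using contf monof f1 by (simp add: circle_reparam_def)
  moreover have "\<gamma> = \<gamma>' \<circ> f" using eq by auto
  ultimately show ?thesis using oriented_knot_reparam by simp
qed

lemma is_link_closed_braid: "is_link (closed_braid_components w)"
proof -
  let ?L = "closed_braid_components w"
  let ?P = "(\<lambda>q. (of_real (sqrt (1 - (cmod q)\<^sup>2)), q)) ` strands_at w 0 :: (complex \<times> complex) set"
  have same: "K = K'" if "K \<in> ?L" "K' \<in> ?L" "x \<in> knot_points K" "x \<in> knot_points K'" for K K' x
  proof -
    obtain \<gamma> where g: "K = oriented_knot \<gamma>" "simple_loop \<gamma>" "range \<gamma> \<subseteq> closed_braid_points w" "winds_positively \<gamma>"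
      using \<open>K \<in> ?L\<close> unfolding closed_braid_components_def by blast
    obtain \<gamma>' where g': "K' = oriented_knot \<gamma>'" "simple_loop \<gamma>'" "range \<gamma>' \<subseteq> closed_braid_points w" "winds_positively \<gamma>'"
      using \<open>K' \<in> ?L\<close> unfolding closed_braid_components_def by blast
    have "x \<in> range \<gamma>" "x \<in> range \<gamma>'" using that(3,4) g(1) g'(1) by (simp_all add: knot_points_oriented_knot)
    then obtain a b where "\<gamma> a = \<gamma>' b" unfolding image_iff by blast
    then have "oriented_knot \<gamma> = oriented_knot \<gamma>'"
      by (rule positive_loops_meet[OF g(2-4) g'(2-4)])
    then show ?thesis by (simp only: g(1) g'(1))
  qed
  have base: "\<exists>x\<in>?P. x \<in> knot_points K" if "K \<in> ?L" for K
  proof -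
    obtain \<gamma> where g: "K = oriented_knot \<gamma>" "simple_loop \<gamma>" "range \<gamma> \<subseteq> closed_braid_points w" "winds_positively \<gamma>"
      using \<open>K \<in> ?L\<close> unfolding closed_braid_components_def by blast
    obtain \<phi> where p: "continuous_on UNIV \<phi>" "strict_mono \<phi>"
      "\<And>t. fst (\<gamma> t) = of_real (cmod (fst (\<gamma> t))) * cis (\<phi> t)"
      using g(4) by (auto simp: winds_positively_def)
    obtain c where c: "c > 0" "\<And>t. \<phi> (t + 1) = \<phi> t + c" using positive_lift[OF g(2,3) p] by blast
    obtain iv where chi: "\<And>x. \<phi> (iv x) = x"
      using real_strict_mono_inverse[OF p(1,2) c(2,1)] by blast
    have "\<gamma> (iv 0) \<in> closed_braid_points w" using g(3) by auto
    from closed_braid_pointD[OF this p(3)] have "\<gamma> (iv 0) \<in> ?P"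
      by (simp add: chi image_iff prod_eq_iff)
    moreover have "\<gamma> (iv 0) \<in> knot_points K" by (simp add: g(1) knot_points_oriented_knot)
    ultimately show ?thesis by blast
  qed
  then have "\<forall>K\<in>?L. \<exists>x. x \<in> ?P \<and> x \<in> knot_points K" by blast
  then obtain pt where pt: "\<forall>K\<in>?L. pt K \<in> ?P \<and> pt K \<in> knot_points K" by (rule bchoice[THEN exE])
  have "inj_on pt ?L"
  proof (rule inj_onI)
    fix K K' assume "K \<in> ?L" "K' \<in> ?L" "pt K = pt K'"
    moreover from this pt have "pt K \<in> knot_points K" "pt K' \<in> knot_points K'" by blast+
    ultimately show "K = K'" using same[of K K' "pt K"] by metis
  qed
  moreover have "pt ` ?L \<subseteq> ?P" using pt by blast
  moreover have "finite ?P" using strands_at_finite by blast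
  ultimately have "finite ?L" using finite_imageD finite_subset by blast
  then show ?thesis
    unfolding is_link_def
  proof (intro conjI ballI)
    show "\<exists>\<gamma>. simple_loop \<gamma> \<and> K = oriented_knot \<gamma>" if "K \<in> ?L" for K
      using that by (auto simp: closed_braid_components_def)
    show "pairwise (\<lambda>K K'. knot_points K \<inter> knot_points K' = {}) ?L"
      using same by (auto simp: pairwise_def)
  qed
qed

lift_definition closed_braid :: "braid_word \<Rightarrow> olink" is closed_braid_components
  by (rule is_link_closed_braid)

text \<open>The oriented link type of the closure of a braid, as an isotopy class of oriented links. Words that
  represent the same braid have isotopic closures, so this is a single class.\<close>

definition braid_closure :: "braid \<Rightarrow> olink set" where
  "braid_closure \<beta> = {L. \<exists>w. braid_of w = \<beta> \<and> isotopic (closed_braid w) L}"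

end

theory Submission
  imports Defs
begin

text \<open>A point of the 3-sphere has polar coordinates: the argument of its first coordinate, in turns,
  and its second coordinate in the unit disc. Motions that act on the disc fibrewise and fix its
  boundary, combined with reparametrizations of the circle, give ambient isotopies. They show that
  closed braids do not change when the word is rotated cyclically or when a pair of inverse letters
  is inserted, so the closure is invariant under conjugation. Mirroring a closed braid inverts every
  letter; reversing it and turning it over reverses the word. Everything else is algebra in the
  braid group, where the half turn conjugates each generator to the other one.\<close>

section \<open>Polar coordinates on the 3-sphere\<close>

definition pt :: "real \<Rightarrow> complex \<Rightarrow> complex \<times> complex" where
  "pt t q = (of_real (sqrt (1 - (cmod q)\<^sup>2)) * cis (2 * pi * t), q)"

definition turn :: "complex \<times> complex \<Rightarrow> real" where
  "turn x = Arg2pi (fst x) / (2 * pi)"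

lemma snd_pt [simp]: "snd (pt t q) = q"
  by (simp add: pt_def)

lemma cis_2pi_eq_iff: "cis (2 * pi * s) = cis (2 * pi * t) \<longleftrightarrow> s - t \<in> \<int>"
proof
  assume "cis (2 * pi * s) = cis (2 * pi * t)"
  then obtain k :: int where "2 * pi * s = 2 * pi * t + 2 * pi * of_int k" by (rule cis_eqD)
  then have "2 * pi * (s - t) = 2 * pi * of_int k" by (simp add: algebra_simps)
  then show "s - t \<in> \<int>" by simp
next
  assume "s - t \<in> \<int>"
  then have "cis (2 * pi * t + 2 * pi * (s - t)) = cis (2 * pi * t)"
    by (simp only: cis_mult[symmetric] cis_multiple_2pi mult_1_right)
  then show "cis (2 * pi * s) = cis (2 * pi * t)" by (simp add: algebra_simps)
qed

lemma pt_shift: "s - t \<in> \<int> \<Longrightarrow> pt s q = pt t q"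
  using cis_2pi_eq_iff[of s t] by (simp add: pt_def)

lemma pt_frac [simp]: "pt (frac t) q = pt t q"
  by (rule pt_shift) (simp add: frac_def)

lemma pt_norm_1: "cmod q = 1 \<Longrightarrow> pt s q = pt t q"
  by (simp add: pt_def)

lemma pt_eqD:
  assumes "pt s p = pt t q" "cmod q < 1"
  shows "p = q" "s - t \<in> \<int>"
proof -
  show pq: "p = q" using assms(1) by (simp add: pt_def)
  have "(cmod q)\<^sup>2 < 1" using assms(2) by (simp add: power_less_one_iff)
  then have "cis (2 * pi * s) = cis (2 * pi * t)" using assms(1) pq by (simp add: pt_def)
  then show "s - t \<in> \<int>" by (simp add: cis_2pi_eq_iff)
qed

lemma norm_fst_pt: "cmod q \<le> 1 \<Longrightarrow> cmod (fst (pt t q)) = sqrt (1 - (cmod q)\<^sup>2)"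
  by (simp add: pt_def norm_mult power_le_one)

lemma pt_in_S3: "cmod q \<le> 1 \<Longrightarrow> pt t q \<in> S3"
proof -
  assume q: "cmod q \<le> 1"
  then have "(cmod q)\<^sup>2 \<le> 1" by (simp add: power_le_one)
  then show ?thesis
    using norm_fst_pt[OF q, of t] by (simp add: S3_def norm_prod_def)
qed

lemma S3_norms: "x \<in> S3 \<Longrightarrow> (cmod (fst x))\<^sup>2 + (cmod (snd x))\<^sup>2 = 1"
  by (cases x) (simp add: S3_def norm_prod_def)

lemma S3_norm_snd:
  assumes "x \<in> S3"
  shows "cmod (snd x) \<le> 1"
proof (rule power2_le_imp_le)
  have "0 \<le> (cmod (fst x))\<^sup>2" by (rule zero_le_power2)
  then show "(cmod (snd x))\<^sup>2 \<le> 1\<^sup>2" using S3_norms[OF assms] unfolding one_power2 by linarith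
qed simp

lemma S3_polar:
  assumes "x \<in> S3" "fst x = of_real (cmod (fst x)) * cis \<theta>"
  shows "x = pt (\<theta> / (2 * pi)) (snd x)"
proof -
  have "sqrt (1 - (cmod (snd x))\<^sup>2) = cmod (fst x)"
    using S3_norms[OF assms(1)] by (intro real_sqrt_unique) auto
  then show ?thesis using assms(2) by (simp add: pt_def prod_eq_iff)
qed

lemma turn_bounds: "0 \<le> turn x" "turn x < 1"
  using Arg2pi[of "fst x"] by (auto simp: turn_def)

lemma pt_turn: "x \<in> S3 \<Longrightarrow> pt (turn x) (snd x) = x"
  unfolding turn_def by (rule S3_polar[symmetric]) (use Arg2pi[of "fst x"] in \<open>auto simp: is_Arg_def cis_conv_exp\<close>)

lemma turn_pt: "cmod q < 1 \<Longrightarrow> turn (pt t q) = frac t"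
proof -
  assume q: "cmod q < 1"
  then have "pt (turn (pt t q)) q = pt t q" using pt_turn[of "pt t q"] pt_in_S3[of q t] by simp
  then have "t - turn (pt t q) \<in> \<int>" using pt_eqD(2)[OF _ q] by metis
  then have "frac t = turn (pt t q)" using turn_bounds by (simp add: frac_unique_iff)
  then show ?thesis by simp
qed

lemma winds_positively_pt_iff:
  assumes "range \<gamma> \<subseteq> S3"
  shows "winds_positively \<gamma> \<longleftrightarrow>
    (\<exists>\<phi>. continuous_on UNIV \<phi> \<and> strict_mono \<phi> \<and> (\<forall>u. \<gamma> u = pt (\<phi> u) (snd (\<gamma> u))))"
proof
  assume "winds_positively \<gamma>"
  then obtain \<phi> where p: "continuous_on UNIV \<phi>" "strict_mono \<phi>"
    "\<And>t. fst (\<gamma> t) = of_real (cmod (fst (\<gamma> t))) * cis (\<phi> t)"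
    by (auto simp: winds_positively_def)
  have "\<gamma> u = pt (\<phi> u / (2 * pi)) (snd (\<gamma> u))" for u
    using S3_polar p(3) assms by blast
  moreover have "continuous_on UNIV (\<lambda>u. \<phi> u / (2 * pi))" using p(1) by (intro continuous_intros) auto
  moreover have "strict_mono (\<lambda>u. \<phi> u / (2 * pi))"
    using p(2) by (simp add: strict_mono_def divide_strict_right_mono)
  ultimately show "\<exists>\<phi>. continuous_on UNIV \<phi> \<and> strict_mono \<phi> \<and> (\<forall>u. \<gamma> u = pt (\<phi> u) (snd (\<gamma> u)))"
    by blast
next
  assume "\<exists>\<phi>. continuous_on UNIV \<phi> \<and> strict_mono \<phi> \<and> (\<forall>u. \<gamma> u = pt (\<phi> u) (snd (\<gamma> u)))"
  then obtain \<phi> where p: "continuous_on UNIV \<phi>" "strict_mono \<phi>" "\<And>u. \<gamma> u = pt (\<phi> u) (snd (\<gamma> u))"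
    by blast
  have "fst (\<gamma> u) = of_real (cmod (fst (\<gamma> u))) * cis (2 * pi * \<phi> u)" for u
  proof -
    have "cmod (snd (\<gamma> u)) \<le> 1" using assms by (intro S3_norm_snd) auto
    then show ?thesis using norm_fst_pt p(3)[of u] by (metis fst_conv pt_def)
  qed
  moreover have "continuous_on UNIV (\<lambda>u. 2 * pi * \<phi> u)" using p(1) by (intro continuous_intros)
  moreover have "strict_mono (\<lambda>u. 2 * pi * \<phi> u)" using p(2) by (simp add: strict_mono_def)
  ultimately show "winds_positively \<gamma>" unfolding winds_positively_def by blast
qed

definition winding_map :: "(complex \<times> complex \<Rightarrow> complex \<times> complex) \<Rightarrow> bool" where
  "winding_map h \<longleftrightarrow> (\<exists>f. continuous_on UNIV f \<and> strict_mono f \<and>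
     (\<forall>t q. cmod q \<le> 1 \<longrightarrow> (\<exists>q'. h (pt t q) = pt (f t) q')))"

lemma winds_positively_map:
  assumes "winding_map h" "range \<gamma> \<subseteq> S3" "range (h \<circ> \<gamma>) \<subseteq> S3" "winds_positively \<gamma>"
  shows "winds_positively (h \<circ> \<gamma>)"
proof -
  obtain f where f: "continuous_on UNIV f" "strict_mono f"
    "\<And>t q. cmod q \<le> 1 \<Longrightarrow> \<exists>q'. h (pt t q) = pt (f t) q'"
    using assms(1) unfolding winding_map_def by blast
  obtain \<phi> where p: "continuous_on UNIV \<phi>" "strict_mono \<phi>" "\<And>u. \<gamma> u = pt (\<phi> u) (snd (\<gamma> u))"
    using assms(2,4) winds_positively_pt_iff by blast
  have "(h \<circ> \<gamma>) u = pt ((f \<circ> \<phi>) u) (snd ((h \<circ> \<gamma>) u))" for u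
  proof -
    have "cmod (snd (\<gamma> u)) \<le> 1" using assms(2) by (intro S3_norm_snd) auto
    then obtain q' where "h (pt (\<phi> u) (snd (\<gamma> u))) = pt (f (\<phi> u)) q'" using f(3) by blast
    then show ?thesis using p(3)[of u] by simp
  qed
  moreover have "continuous_on UNIV (f \<circ> \<phi>)"
    using p(1) f(1) by (metis continuous_on_compose continuous_on_subset subset_UNIV)
  moreover have "strict_mono (f \<circ> \<phi>)" using f(2) p(2) by (simp add: strict_mono_def)
  ultimately show ?thesis using winds_positively_pt_iff[OF assms(3)] by blast
qed


section \<open>Links carried by a set of points\<close>

definition loops_in :: "(complex \<times> complex) set \<Rightarrow> curve set set" where
  "loops_in P = {oriented_knot \<gamma> | \<gamma>. simple_loop \<gamma> \<and> range \<gamma> \<subseteq> P \<and> winds_positively \<gamma>}"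

lemma closed_braid_components_eq: "closed_braid_components w = loops_in (closed_braid_points w)"
  by (simp add: closed_braid_components_def loops_in_def)

lemma map_link_comp: "map_link h (map_link k L) = map_link (h \<circ> k) L"
  by (simp add: map_link_def image_image comp_assoc)

lemma oriented_knot_in_S3: "simple_loop \<gamma> \<Longrightarrow> \<delta> \<in> oriented_knot \<gamma> \<Longrightarrow> range \<delta> \<subseteq> S3"
  unfolding oriented_knot_def simple_loop_def by (auto simp del: split_paired_All simp: image_subset_iff)

lemma loop_in_S3: "K \<in> L \<Longrightarrow> is_link L \<Longrightarrow> \<gamma> \<in> K \<Longrightarrow> range \<gamma> \<subseteq> S3"
  unfolding is_link_def using oriented_knot_in_S3 by metis

lemma map_link_cong:
  assumes "\<And>x. x \<in> S3 \<Longrightarrow> h x = k x" "\<And>K \<gamma>. K \<in> L \<Longrightarrow> \<gamma> \<in> K \<Longrightarrow> range \<gamma> \<subseteq> S3"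
  shows "map_link h L = map_link k L"
  unfolding map_link_def
proof (intro image_cong refl)
  fix K \<gamma> assume "K \<in> L" "\<gamma> \<in> K"
  then have "\<gamma> u \<in> S3" for u using assms(2)[of K \<gamma>] by auto
  then show "h \<circ> \<gamma> = k \<circ> \<gamma>" using assms(1) by (simp add: fun_eq_iff)
qed

lemma map_link_id [simp]: "map_link id L = L"
  by (simp add: map_link_def)

lemma loops_in_S3: "K \<in> loops_in P \<Longrightarrow> \<gamma> \<in> K \<Longrightarrow> range \<gamma> \<subseteq> S3"
  unfolding loops_in_def using oriented_knot_in_S3 by blast

lemma map_loops_in_subset:
  assumes "winding_map h" "continuous_on S3 h" "h ` S3 \<subseteq> S3" "inj_on h S3"
  shows "map_link h (loops_in P) \<subseteq> loops_in (h ` P)"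
proof
  fix K assume "K \<in> map_link h (loops_in P)"
  then obtain \<gamma> where g: "simple_loop \<gamma>" "range \<gamma> \<subseteq> P" "winds_positively \<gamma>"
    "K = (\<lambda>\<gamma>. h \<circ> \<gamma>) ` oriented_knot \<gamma>"
    by (auto simp: map_link_def loops_in_def)
  have l: "simple_loop (h \<circ> \<gamma>)" using simple_loop_map[OF g(1) assms(2-4)] .
  moreover have "winds_positively (h \<circ> \<gamma>)"
    using winds_positively_map[OF assms(1) _ _ g(3)] g(1) l by (simp add: simple_loop_def)
  moreover have "range (h \<circ> \<gamma>) \<subseteq> h ` P" using g(2) by auto
  ultimately show "K \<in> loops_in (h ` P)" unfolding loops_in_def g(4) map_oriented_knot by blast
qed

lemma map_loops_in:
  assumes hom: "homeomorphism S3 S3 h k" and "winding_map h" "winding_map k" "P \<subseteq> S3"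
  shows "map_link h (loops_in P) = loops_in (h ` P)"
proof
  have hk: "continuous_on S3 h" "h ` S3 \<subseteq> S3" "inj_on h S3" "continuous_on S3 k" "k ` S3 \<subseteq> S3" "inj_on k S3"
    using hom unfolding homeomorphism_def by (auto intro: inj_on_inverseI)
  show "map_link h (loops_in P) \<subseteq> loops_in (h ` P)" using map_loops_in_subset assms(2) hk by blast
  have "k (h x) = x" if "x \<in> P" for x
    using hom that assms(4) unfolding homeomorphism_def by blast
  then have "k ` (h ` P) = P" by (simp add: image_image)
  then have "map_link k (loops_in (h ` P)) \<subseteq> loops_in P"
    using map_loops_in_subset[OF assms(3) hk(4-6), of "h ` P"] by simp
  then have "map_link h (map_link k (loops_in (h ` P))) \<subseteq> map_link h (loops_in P)"
    unfolding map_link_def[of h] by blast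
  moreover have "map_link h (map_link k (loops_in (h ` P))) = map_link id (loops_in (h ` P))"
    unfolding map_link_comp by (rule map_link_cong) (use hom loops_in_S3 in \<open>auto simp: homeomorphism_def\<close>)
  ultimately show "loops_in (h ` P) \<subseteq> map_link h (loops_in P)" by simp
qed

section \<open>Isotopies\<close>

lemma ambient_isotopy_in_S3:
  "ambient_isotopy H \<Longrightarrow> t \<in> {0..1} \<Longrightarrow> x \<in> S3 \<Longrightarrow> H t x \<in> S3"
  unfolding ambient_isotopy_def homeomorphism_def by blast

lemma ambient_isotopy_homeomorphism:
  "ambient_isotopy H \<Longrightarrow> t \<in> {0..1} \<Longrightarrow> \<exists>g. homeomorphism S3 S3 (H t) g"
  by (simp add: ambient_isotopy_def)

lemma ambient_isotopy_comp:
  assumes H: "ambient_isotopy H" and K: "ambient_isotopy K"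
  shows "ambient_isotopy (\<lambda>t. K t \<circ> H t)"
  unfolding ambient_isotopy_def
proof (intro conjI ballI)
  have cH: "continuous_on ({0..1} \<times> S3) (\<lambda>p. H (fst p) (snd p))"
    using H by (simp add: ambient_isotopy_def split_beta)
  have cK: "continuous_on ({0..1} \<times> S3) (\<lambda>p. K (fst p) (snd p))"
    using K by (simp add: ambient_isotopy_def split_beta)
  have "continuous_on ({0..1} \<times> S3) (\<lambda>p. (fst p, H (fst p) (snd p)))"
    by (intro continuous_intros cH)
  moreover have "(\<lambda>p. (fst p, H (fst p) (snd p))) ` ({0..1} \<times> S3) \<subseteq> {0..1} \<times> S3"
    using ambient_isotopy_in_S3[OF H] by auto
  ultimately show "continuous_on ({0..1} \<times> S3) (\<lambda>(t, x). (K t \<circ> H t) x)"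
    using continuous_on_compose2[OF cK, of _ "\<lambda>p. (fst p, H (fst p) (snd p))"]
    by (simp add: split_beta del: split_paired_All)
next
  fix t :: real assume t: "t \<in> {0..1}"
  then obtain g k where "homeomorphism S3 S3 (H t) g" "homeomorphism S3 S3 (K t) k"
    using H K by (meson ambient_isotopy_def)
  then show "\<exists>g. homeomorphism S3 S3 (K t \<circ> H t) g" using homeomorphism_compose by blast
next
  fix x assume "x \<in> S3"
  then show "(K 0 \<circ> H 0) x = x" using H K by (simp add: ambient_isotopy_def)
qed

lemma ambient_isotopy_inverse:
  assumes H: "ambient_isotopy H"
  obtains K where "ambient_isotopy K" "\<And>x. x \<in> S3 \<Longrightarrow> K 1 (H 1 x) = x"
proof -
  obtain g where g: "homeomorphism S3 S3 (H 1) g"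
    using ambient_isotopy_homeomorphism[OF H, of 1] by auto
  have gS: "g x \<in> S3" if "x \<in> S3" for x using g that unfolding homeomorphism_def by blast
  have cH: "continuous_on ({0..1} \<times> S3) (\<lambda>p. H (fst p) (snd p))"
    using H by (simp add: ambient_isotopy_def split_beta)
  have cg: "continuous_on S3 g" using g by (simp add: homeomorphism_def)
  have "ambient_isotopy (\<lambda>t. H (1 - t) \<circ> g)"
    unfolding ambient_isotopy_def
  proof (intro conjI ballI)
    have "continuous_on ({0..1} \<times> S3) (\<lambda>p :: real \<times> complex \<times> complex. (1 - fst p, g (snd p)))"
      by (intro continuous_intros continuous_on_compose2[OF cg]) auto
    moreover have "(\<lambda>p :: real \<times> complex \<times> complex. (1 - fst p, g (snd p))) ` ({0..1} \<times> S3) \<subseteq> {0..1} \<times> S3"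
      using gS by auto
    ultimately show "continuous_on ({0..1} \<times> S3) (\<lambda>(t, x). (H (1 - t) \<circ> g) x)"
      using continuous_on_compose2[OF cH, of _ "\<lambda>p. (1 - fst p, g (snd p))"]
      by (simp add: split_beta del: split_paired_All)
  next
    fix t :: real assume "t \<in> {0..1}"
    then have "1 - t \<in> {0..1}" by auto
    then obtain k where "homeomorphism S3 S3 (H (1 - t)) k" using H by (meson ambient_isotopy_def)
    then show "\<exists>k. homeomorphism S3 S3 (H (1 - t) \<circ> g) k"
      using homeomorphism_compose homeomorphism_symD[OF g] by blast
  next
    fix x assume "x \<in> S3"
    then show "(H (1 - 0) \<circ> g) x = x" using g by (simp add: homeomorphism_def)
  qed
  moreover have "(H (1 - 1) \<circ> g) (H 1 x) = x" if "x \<in> S3" for x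
    using g H that by (simp add: homeomorphism_def ambient_isotopy_def)
  ultimately show thesis by (rule that)
qed

lemma homeomorphism_reflection: "homeomorphism S3 S3 reflection reflection"
proof -
  have rr: "reflection (reflection x) = x" for x by (simp add: reflection_def)
  then have "S3 \<subseteq> reflection ` S3" using reflection_S3(1) by (metis image_subset_iff image_eqI subsetI)
  then show ?thesis using reflection_S3 rr unfolding homeomorphism_def by auto
qed

lemma ambient_isotopy_reflect:
  assumes H: "ambient_isotopy H"
  shows "ambient_isotopy (\<lambda>t. reflection \<circ> (H t \<circ> reflection))"
  unfolding ambient_isotopy_def
proof (intro conjI ballI)
  note r = homeomorphism_reflection
  have cH: "continuous_on ({0..1} \<times> S3) (\<lambda>p. H (fst p) (snd p))"
    using H by (simp add: ambient_isotopy_def split_beta)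
  have rS: "reflection x \<in> S3" if "x \<in> S3" for x using reflection_S3(1) that by blast
  have "continuous_on ({0..1} \<times> S3) (\<lambda>p :: real \<times> complex \<times> complex. (fst p, reflection (snd p)))"
    by (intro continuous_intros continuous_on_compose2[OF reflection_S3(2)]) auto
  moreover have "(\<lambda>p :: real \<times> complex \<times> complex. (fst p, reflection (snd p))) ` ({0..1} \<times> S3) \<subseteq> {0..1} \<times> S3"
    using rS by auto
  ultimately have "continuous_on ({0..1} \<times> S3) (\<lambda>p. H (fst p) (reflection (snd p)))"
    using continuous_on_compose2[OF cH, of _ "\<lambda>p. (fst p, reflection (snd p))"] by simp
  moreover have "(\<lambda>p. H (fst p) (reflection (snd p))) ` ({0..1} \<times> S3) \<subseteq> S3"
    using ambient_isotopy_in_S3[OF H] rS by (simp add: image_subset_iff)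
  ultimately show "continuous_on ({0..1} \<times> S3) (\<lambda>(t, x). (reflection \<circ> (H t \<circ> reflection)) x)"
    using continuous_on_compose2[OF reflection_S3(2), of _ "\<lambda>p. H (fst p) (reflection (snd p))"]
    by (simp add: split_beta)
  show "\<exists>g. homeomorphism S3 S3 (reflection \<circ> (H t \<circ> reflection)) g" if t: "t \<in> {0..1}" for t
  proof -
    obtain k where "homeomorphism S3 S3 (H t) k" using H t by (meson ambient_isotopy_def)
    then show ?thesis using homeomorphism_compose r by blast
  qed
  show "(reflection \<circ> (H 0 \<circ> reflection)) x = x" if "x \<in> S3" for x
    using H rS[OF that] by (simp add: ambient_isotopy_def) (simp add: reflection_def)
qed

lemma Rep_olink_in_S3: "K \<in> Rep_olink L \<Longrightarrow> \<gamma> \<in> K \<Longrightarrow> range \<gamma> \<subseteq> S3"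
  using Rep_olink[of L] loop_in_S3 by blast

lemma isotopicI:
  "ambient_isotopy H \<Longrightarrow> Rep_olink L' = map_link (H 1) (Rep_olink L) \<Longrightarrow> isotopic L L'"
  unfolding isotopic.rep_eq by blast

lemma isotopic_trans:
  assumes "isotopic L L'" "isotopic L' L''"
  shows "isotopic L L''"
proof -
  obtain H K where "ambient_isotopy H" "Rep_olink L' = map_link (H 1) (Rep_olink L)"
    "ambient_isotopy K" "Rep_olink L'' = map_link (K 1) (Rep_olink L')"
    using assms unfolding isotopic.rep_eq by blast
  then show ?thesis
    by (metis isotopicI ambient_isotopy_comp map_link_comp)
qed

lemma isotopic_sym:
  assumes "isotopic L L'"
  shows "isotopic L' L"
proof -
  obtain H where H: "ambient_isotopy H" "Rep_olink L' = map_link (H 1) (Rep_olink L)"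
    using assms unfolding isotopic.rep_eq by blast
  obtain K where K: "ambient_isotopy K" "\<And>x. x \<in> S3 \<Longrightarrow> K 1 (H 1 x) = x"
    using ambient_isotopy_inverse[OF H(1)] by blast
  have "map_link (K 1 \<circ> H 1) (Rep_olink L) = map_link id (Rep_olink L)"
    by (rule map_link_cong) (use K(2) Rep_olink_in_S3 in auto)
  then show ?thesis by (intro isotopicI[OF K(1)]) (simp add: H(2) map_link_comp)
qed

lemma isotopic_mirror:
  assumes "isotopic L L'"
  shows "isotopic (mirror L) (mirror L')"
proof -
  obtain H where H: "ambient_isotopy H" "Rep_olink L' = map_link (H 1) (Rep_olink L)"
    using assms unfolding isotopic.rep_eq by blast
  have "reflection \<circ> (H 1 \<circ> reflection) \<circ> reflection = reflection \<circ> H 1"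
    by (simp add: fun_eq_iff reflection_def)
  then show ?thesis
    by (intro isotopicI[OF ambient_isotopy_reflect[OF H(1)]]) (simp add: H(2) mirror.rep_eq map_link_comp)
qed

lemma map_reverse_link: "map_link h (reverse_link L) = reverse_link (map_link h L)"
  by (simp add: map_link_def reverse_link_def image_image comp_def)

lemma isotopic_reverse:
  assumes "isotopic L L'"
  shows "isotopic (reverse L) (reverse L')"
  using assms unfolding isotopic.rep_eq reverse.rep_eq by (auto simp: map_reverse_link)

lemma continuous_on_compact_quotient:
  fixes p :: "'a::topological_space \<Rightarrow> 'b::t2_space" and h :: "'b \<Rightarrow> 'c::topological_space"
  assumes "compact A" "continuous_on A p" "p ` A = B" "continuous_on A (\<lambda>x. h (p x))"
  shows "continuous_on B h"
  unfolding continuous_on_closed_invariant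
proof (intro allI impI)
  fix C :: "'c set" assume "closed C"
  then obtain D where D: "closed D" "D \<inter> A = (\<lambda>x. h (p x)) -` C \<inter> A"
    using assms(4) unfolding continuous_on_closed_invariant by blast
  have "compact (A \<inter> D)" using assms(1) D(1) by (rule compact_Int_closed)
  then have "compact (p ` (A \<inter> D))"
    using assms(2) by (intro compact_continuous_image) (auto intro: continuous_on_subset)
  then have "closed (p ` (A \<inter> D))" by (rule compact_imp_closed)
  moreover have "p ` (A \<inter> D) \<inter> B = h -` C \<inter> B"
    using D(2) assms(3) by auto
  ultimately show "\<exists>D. closed D \<and> D \<inter> B = h -` C \<inter> B" by blast
qed

lemma continuous_on_pt [continuous_intros]:
  "continuous_on A f \<Longrightarrow> continuous_on A g \<Longrightarrow> continuous_on A (\<lambda>x. pt (f x) (g x))"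
  unfolding pt_def by (intro continuous_intros)

lemma circle_reparam_int:
  assumes "circle_reparam f"
  shows "f (t + of_int k) = f t + of_int k"
proof -
  have 1: "f (s + 1) = f s + 1" for s using assms by (simp add: circle_reparam_def)
  show ?thesis
  proof (induction k rule: int_induct[where k = 0])
    case (step1 i)
    show ?case using 1[of "t + of_int i"] step1 by (simp add: algebra_simps)
  next
    case (step2 i)
    show ?case using 1[of "t + of_int i - 1"] step2 by (simp add: algebra_simps)
  qed simp
qed

lemma circle_reparam_diff_Ints:
  assumes f: "circle_reparam f" and "f s - f t \<in> \<int>"
  shows "s - t \<in> \<int>"
proof -
  obtain k where "f s - f t = of_int k" using assms(2) by (elim Ints_cases)
  then have "f s = f (t + of_int k)" using circle_reparam_int[OF f, of t k] by simp
  then have "s = t + of_int k"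
    using f strict_mono_eq unfolding circle_reparam_def by blast
  then show ?thesis by simp
qed

text \<open>Continuity can be checked in polar coordinates, since a compact product of intervals and a
  disc maps onto the product of an interval and the sphere.\<close>

lemma polar_isotopy:
  fixes f :: "real \<Rightarrow> real \<Rightarrow> real" and F :: "real \<Rightarrow> real \<Rightarrow> complex \<Rightarrow> complex"
  assumes f: "\<And>s. s \<in> {0..1} \<Longrightarrow> circle_reparam (f s)" "\<And>t. f 0 t = t"
    and f_cont: "continuous_on ({0..1} \<times> {0..1}) (\<lambda>(s, t). f s t)"
    and F: "\<And>s t. s \<in> {0..1} \<Longrightarrow> t \<in> {0..1} \<Longrightarrow> bij_betw (F s t) (cball 0 1) (cball 0 1)"
      "\<And>s q. F s 1 q = F s 0 q" "\<And>s t q. cmod q = 1 \<Longrightarrow> F s t q = q" "\<And>t q. F 0 t q = q"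
    and F_cont: "continuous_on ({0..1} \<times> {0..1} \<times> cball 0 1) (\<lambda>(s, t, q). F s t q)"
  obtains H where "ambient_isotopy H"
    "\<And>t q. cmod q \<le> 1 \<Longrightarrow> H 1 (pt t q) = pt (f 1 t) (F 1 (frac t) q)"
    "\<And>P. P \<subseteq> S3 \<Longrightarrow> map_link (H 1) (loops_in P) = loops_in (H 1 ` P)"
proof -
  define H where "H s x = pt (f s (turn x)) (F s (turn x) (snd x))" for s x
  have Fb: "cmod (F s t q) \<le> 1" if "s \<in> {0..1}" "t \<in> {0..1}" "cmod q \<le> 1" for s t q
    using bij_betwE[OF F(1)[OF that(1,2)]] that(3) by auto
  have H_pt: "H s (pt t q) = pt (f s t) (F s (frac t) q)" if s: "s \<in> {0..1}" and q: "cmod q \<le> 1" for s t q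
  proof (cases "cmod q = 1")
    case True
    then show ?thesis using F(3)[OF True] pt_norm_1[OF True] by (simp add: H_def)
  next
    case False
    then have "turn (pt t q) = frac t" using q turn_pt by simp
    moreover have "f s t = f s (frac t) + of_int \<lfloor>t\<rfloor>"
      using circle_reparam_int[OF f(1)[OF s], of "frac t" "\<lfloor>t\<rfloor>"] by (simp add: frac_def)
    then have "pt (f s t) q' = pt (f s (frac t)) q'" for q' by (intro pt_shift) simp
    ultimately show ?thesis by (simp add: H_def)
  qed
  have frac01: "frac t \<in> {0..1}" for t :: real
    using frac_lt_1[of t] frac_ge_0[of t] by simp
  have HS: "H s x \<in> S3" if "s \<in> {0..1}" "x \<in> S3" for s x
    unfolding H_def using that turn_bounds[of x] by (intro pt_in_S3 Fb S3_norm_snd) auto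
  have cont: "continuous_on ({0..1} \<times> S3) (\<lambda>(s, x). H s x)"
  proof (rule continuous_on_compact_quotient)
    let ?A = "{0..1} \<times> {0..1} \<times> cball 0 1 :: (real \<times> real \<times> complex) set"
    let ?p = "\<lambda>(s, t, q). (s, pt t q) :: real \<times> complex \<times> complex"
    show "compact ?A" by (intro compact_Times compact_Icc compact_cball)
    show "continuous_on ?A ?p" unfolding split_beta by (intro continuous_intros)
    show "?p ` ?A = {0..1} \<times> S3"
    proof (intro subset_antisym subsetI)
      fix y assume "y \<in> ?p ` ?A"
      then show "y \<in> {0..1} \<times> S3" using pt_in_S3 by auto
    next
      fix y :: "real \<times> complex \<times> complex" assume y: "y \<in> {0..1} \<times> S3"
      then have "y = ?p (fst y, turn (snd y), snd (snd y))"
        using pt_turn[of "snd y"] by (auto simp: split_beta mem_Times_iff prod_eq_iff)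
      moreover have "(fst y, turn (snd y), snd (snd y)) \<in> ?A"
        using y turn_bounds[of "snd y"] S3_norm_snd[of "snd y"] by (simp add: mem_Times_iff)
      ultimately show "y \<in> ?p ` ?A" by (rule image_eqI)
    qed
    have eq: "(case ?p x of (s, y) \<Rightarrow> H s y) = pt (f (fst x) (fst (snd x))) (F (fst x) (fst (snd x)) (snd (snd x)))"
      if "x \<in> ?A" for x
    proof -
      obtain s t q where x: "x = (s, t, q)" by (rule prod_cases3)
      have b: "s \<in> {0..1}" "t \<in> {0..1}" "cmod q \<le> 1" using that by (simp_all add: x)
      have "F s (frac t) q = F s t q" using b(2) F(2) by (cases "t = 1") (auto simp: frac_eq)
      then show ?thesis using H_pt[OF b(1,3), of t] by (simp add: x)
    qed
    have "continuous_on ?A (\<lambda>x. (fst x, fst (snd x)))" by (intro continuous_intros)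
    then have c1: "continuous_on ?A (\<lambda>x. f (fst x) (fst (snd x)))"
      using continuous_on_compose2[OF f_cont] by (force simp: split_beta)
    have c2: "continuous_on ?A (\<lambda>x. F (fst x) (fst (snd x)) (snd (snd x)))"
      using F_cont by (simp add: split_beta)
    have "continuous_on ?A (\<lambda>x. pt (f (fst x) (fst (snd x))) (F (fst x) (fst (snd x)) (snd (snd x))))"
      using c1 c2 by (rule continuous_on_pt)
    then show "continuous_on ?A (\<lambda>x. case ?p x of (s, y) \<Rightarrow> H s y)"
      by (rule continuous_on_eq) (rule eq[symmetric])
  qed
  have cs: "continuous_on S3 (H s)" if "s \<in> {0..1}" for s
  proof -
    have "continuous_on S3 (\<lambda>x. (s, x))" by (intro continuous_intros)
    then have "continuous_on S3 (\<lambda>x. case (s, x) of (s, x) \<Rightarrow> H s x)"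
      by (rule continuous_on_compose2[OF cont]) (use that in auto)
    then show ?thesis by simp
  qed
  have inj: "inj_on (H s) S3" if s: "s \<in> {0..1}" for s
  proof (rule inj_onI)
    fix x y assume x: "x \<in> S3" and y: "y \<in> S3" and eq: "H s x = H s y"
    have t: "turn x \<in> {0..1}" "turn y \<in> {0..1}" using turn_bounds[of x] turn_bounds[of y] by auto
    have n: "cmod (snd x) \<le> 1" "cmod (snd y) \<le> 1" using x y S3_norm_snd by auto
    have inj: "inj_on (F s u) (cball 0 1)" if "u \<in> {0..1}" for u using F(1)[OF s that] by (rule bij_betw_imp_inj_on)
    have Feq: "F s (turn x) (snd x) = F s (turn y) (snd y)" using eq by (metis H_def snd_pt)
    show "x = y"
    proof (cases "cmod (F s (turn y) (snd y)) < 1")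
      case True
      then have "f s (turn x) - f s (turn y) \<in> \<int>" using eq pt_eqD(2) by (metis H_def)
      then have "turn x - turn y \<in> \<int>" by (rule circle_reparam_diff_Ints[OF f(1)[OF s]])
      then have "turn x = turn y" using turn_bounds[of x] turn_bounds[of y] Ints_nonzero_abs_ge1 by fastforce
      moreover from this have "snd x = snd y" using Feq inj[OF t(2)] n by (auto simp: inj_on_def)
      ultimately show ?thesis using pt_turn x y by metis
    next
      case False
      let ?z = "F s (turn y) (snd y)"
      have z: "cmod ?z = 1" using False Fb[OF s t(2) n(2)] by simp
      have "F s (turn x) ?z = F s (turn x) (snd x)" "F s (turn y) ?z = F s (turn y) (snd y)"
        using F(3)[OF z] Feq by simp_all
      then have "?z = snd x" "?z = snd y"
        using inj[OF t(1)] inj[OF t(2)] n z by (auto simp: inj_on_def)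
      then show ?thesis using pt_turn x y z pt_norm_1 by metis
    qed
  qed
  have onto: "\<exists>g q'. f s g = t \<and> cmod q' \<le> 1 \<and> F s (frac g) q' = q"
    if s: "s \<in> {0..1}" and q: "cmod q \<le> 1" for s t q
  proof -
    obtain g where "f s \<circ> g = id" using f(1)[OF s] circle_reparam_inverse by metis
    then have fg: "f s (g t) = t" by (metis comp_apply id_apply)
    have "q \<in> F s (frac (g t)) ` cball 0 1"
      using F(1)[OF s frac01] q unfolding bij_betw_def by simp
    then obtain q' where "cmod q' \<le> 1" "F s (frac (g t)) q' = q" by auto
    with fg show ?thesis by blast
  qed
  have surj: "H s ` S3 = S3" if s: "s \<in> {0..1}" for s
  proof (intro subset_antisym subsetI)
    fix y assume "y \<in> H s ` S3"
    then show "y \<in> S3" using HS[OF s] by auto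
  next
    fix y assume y: "y \<in> S3"
    obtain g q' where g: "f s g = turn y" "cmod q' \<le> 1" "F s (frac g) q' = snd y"
      using onto[OF s S3_norm_snd[OF y]] by blast
    then have "H s (pt g q') = y" using H_pt[OF s g(2)] pt_turn[OF y] by simp
    then show "y \<in> H s ` S3" using pt_in_S3[OF g(2)] by blast
  qed
  have homeo: "\<exists>g. homeomorphism S3 S3 (H s) g" if "s \<in> {0..1}" for s
    using homeomorphism_compact[OF _ cs surj inj] that by (simp add: S3_def)
  have "H 0 x = x" if "x \<in> S3" for x using pt_turn[OF that] by (simp add: H_def f(2) F(4))
  then have "ambient_isotopy H" unfolding ambient_isotopy_def using cont homeo by blast
  moreover have one: "(1 :: real) \<in> {0..1}" by simp
  note H1 = H_pt[OF one]
  moreover have "map_link (H 1) (loops_in P) = loops_in (H 1 ` P)" if "P \<subseteq> S3" for P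
  proof -
    obtain k where k: "homeomorphism S3 S3 (H 1) k" using homeo[OF one] by blast
    obtain g where g: "circle_reparam g" "f 1 \<circ> g = id" "g \<circ> f 1 = id"
      using f(1)[OF one] circle_reparam_inverse by blast
    have "winding_map (H 1)"
      unfolding winding_map_def using f(1)[OF one] H1 by (auto simp: circle_reparam_def)
    moreover have "\<exists>q'. k (pt t q) = pt (g t) q'" if q: "cmod q \<le> 1" for t q
    proof -
      obtain u q' where u: "f 1 u = t" "cmod q' \<le> 1" "F 1 (frac u) q' = q"
        using onto[OF one q] by blast
      have "u = g t" using u(1) g(3) by (metis comp_apply id_apply)
      then have "pt t q = H 1 (pt (g t) q')" using H1[OF u(2)] u by metis
      then have "k (pt t q) = pt (g t) q'" using k pt_in_S3[OF u(2)] by (simp add: homeomorphism_def)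
      then show ?thesis by blast
    qed
    then have "winding_map k"
      unfolding winding_map_def using g(1) by (auto simp: circle_reparam_def)
    ultimately show ?thesis using map_loops_in[OF k] that by blast
  qed
  ultimately show thesis by (rule that)
qed

section \<open>Tapered rotations of the disc\<close>

text \<open>Rotates the disc of radius 1/4 around the twist centre and fixes every point at distance at
  least 1/2 from it, so that it extends a half twist and is the identity near the unit circle.\<close>

definition taper :: "braid_gen \<Rightarrow> real \<Rightarrow> complex \<Rightarrow> complex" where
  "taper g a q = twist_centre g +
     cis (a * max 0 (min 1 (2 - 4 * cmod (q - twist_centre g)))) * (q - twist_centre g)"

lemma taper_dist [simp]: "cmod (taper g a q - twist_centre g) = cmod (q - twist_centre g)"
  by (simp add: taper_def norm_mult)

lemma taper_0 [simp]: "taper g 0 q = q"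
  by (simp add: taper_def)

lemma taper_add: "taper g a (taper g b q) = taper g (a + b) q"
proof -
  let ?k = "max 0 (min 1 (2 - 4 * cmod (q - twist_centre g)))"
  have "taper g a (taper g b q) = twist_centre g + cis (a * ?k) * (taper g b q - twist_centre g)"
    unfolding taper_def[of g a] by simp
  also have "taper g b q - twist_centre g = cis (b * ?k) * (q - twist_centre g)"
    by (simp add: taper_def)
  also have "cis (a * ?k) * (cis (b * ?k) * (q - twist_centre g)) = cis ((a + b) * ?k) * (q - twist_centre g)"
    by (simp only: mult.assoc[symmetric] cis_mult distrib_right)
  finally show ?thesis by (simp add: taper_def)
qed

lemma norm_twist_centre: "cmod (twist_centre g) = 1 / 4"
  by (cases g) (simp_all add: norm_divide)

lemma taper_far:
  assumes "cmod (q - twist_centre g) \<ge> 1 / 2"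
  shows "taper g a q = q"
proof -
  have "max 0 (min 1 (2 - 4 * cmod (q - twist_centre g))) = 0" using assms by auto
  then show ?thesis unfolding taper_def by simp
qed

lemma taper_boundary: "cmod q = 1 \<Longrightarrow> taper g a q = q"
  using norm_triangle_ineq2[of q "twist_centre g"] norm_twist_centre[of g] by (intro taper_far) auto

lemma taper_disc: "cmod q \<le> 1 \<Longrightarrow> cmod (taper g a q) \<le> 1"
proof (cases "cmod (q - twist_centre g) \<ge> 1 / 2")
  case False
  then have "cmod (taper g a q - twist_centre g) < 1 / 2" by simp
  then show ?thesis
    using norm_triangle_ineq[of "taper g a q - twist_centre g" "twist_centre g"] norm_twist_centre[of g] by auto
qed (simp add: taper_far)

lemma bij_betw_taper: "bij_betw (taper g a) (cball 0 1) (cball 0 1)"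
  by (rule bij_betw_byWitness[where f' = "taper g (- a)"]) (auto simp: taper_add intro: taper_disc)

lemma continuous_on_taper [continuous_intros]:
  "continuous_on A f \<Longrightarrow> continuous_on A h \<Longrightarrow> continuous_on A (\<lambda>x. taper g (f x) (h x))"
  unfolding taper_def by (intro continuous_intros)

lemma cnj_taper: "cnj (taper g a q) = taper g (- a) (cnj q)"
proof -
  have z: "cnj (twist_centre g) = twist_centre g" by (cases g) simp_all
  have "cmod (cnj q - twist_centre g) = cmod (q - twist_centre g)"
    by (metis complex_cnj_diff complex_mod_cnj z)
  then show ?thesis by (simp add: taper_def z cis_cnj)
qed

definition angle :: "braid_gen \<times> bool \<Rightarrow> real" where
  "angle l = (if snd l then pi else - pi)"

lemma base_dist: "p \<in> strand_base \<Longrightarrow>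
    cmod (p - twist_centre g) = 1 / 4 \<or> cmod (p - twist_centre g) = 3 / 4"
  unfolding strand_base_def by (cases g; elim insertE emptyE; hypsubst; simp add: cmod_def)

lemma half_twist_taper:
  assumes "p \<in> strand_base"
  shows "half_twist l s p = taper (fst l) (angle l * s) p"
proof (cases "cmod (p - twist_centre (fst l)) = 1 / 4")
  case True
  then show ?thesis by (simp add: half_twist_def taper_def angle_def Let_def)
next
  case False
  then have "cmod (p - twist_centre (fst l)) = 3 / 4" using base_dist assms by blast
  then show ?thesis using taper_far[of p "fst l"] by (simp add: half_twist_def)
qed

lemma half_twist_image_taper:
  "half_twist l s ` strand_base = taper (fst l) (angle l * s) ` strand_base"
  by (intro image_cong refl half_twist_taper)

lemma taper_angle_base: "taper (fst l) (angle l) ` strand_base = strand_base"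
proof -
  have "cis (angle l) = - 1" by (simp add: angle_def complex_eq_iff)
  moreover have "half_twist l 1 ` strand_base = strand_base"
  proof -
    have n: "cmod (- (1/2) - 1/4) = 3/4" "cmod (1/2 + 1/4) = 3/4" "cmod (- (1/2) + 1/4) = 1/4"
      "cmod (1/2 - 1/4) = 1/4" by (simp_all add: cmod_def)
    have "cis (if snd l then pi * 1 else - (pi * 1)) = - 1" by (simp add: complex_eq_iff)
    then show ?thesis
      using n by (cases "fst l") (auto simp: half_twist_def strand_base_def Let_def field_simps)
  qed
  ultimately show ?thesis using half_twist_image_taper[of l 1] by simp
qed

lemma cnj_base: "cnj ` strand_base = strand_base"
  by (simp add: strand_base_def)

lemma cnj_taper_base: "cnj ` taper g a ` strand_base = taper g (- a) ` strand_base"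
proof -
  have "cnj ` taper g a ` strand_base = taper g (- a) ` cnj ` strand_base"
    unfolding image_image cnj_taper ..
  then show ?thesis by (simp add: cnj_base)
qed

lemma strands_at_eq:
  assumes "t * real (length w) = real i + r" "0 \<le> r" "r < 1" "i < length w"
  shows "strands_at w t = taper (fst (w ! i)) (angle (w ! i) * r) ` strand_base"
proof -
  have "\<lfloor>t * real (length w)\<rfloor> = int i" unfolding assms(1) using assms(2,3) by linarith
  moreover from this have "frac (t * real (length w)) = r" using assms(1) by (simp add: frac_def)
  ultimately show ?thesis
    using assms(4) half_twist_image_taper by (auto simp: strands_at_def)
qed

lemma strands_at_Ints:
  assumes "t * real (length w) = real i" "i < length w"
  shows "strands_at w t = strand_base"
  using strands_at_eq[of t w i 0] assms by simp

text \<open>The value r = 1 is allowed: the end of a letter is the start of the next one.\<close>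

lemma strands_at_eq_closed:
  assumes t: "t * real (length w) = real i + r" "0 \<le> r" "r \<le> 1" "i < length w" "t < 1"
  shows "strands_at w t = taper (fst (w ! i)) (angle (w ! i) * r) ` strand_base"
proof (cases "r < 1")
  case False
  then have r: "r = 1" using t by simp
  have "t * real (length w) < 1 * real (length w)" using t(4,5) by (intro mult_strict_right_mono) auto
  then have "i + 1 < length w" using t(1) r by linarith
  then have "strands_at w t = strand_base" using strands_at_Ints[of t w "i + 1"] t(1) r by simp
  then show ?thesis using r taper_angle_base by simp
qed (use strands_at_eq t in auto)

lemma time_cases:
  assumes "0 \<le> t" "t < 1" "n > 0"
  obtains i r where "t * real n = real i + r" "0 \<le> r" "r < 1" "i < n"
proof
  let ?x = "t * real n"
  have x: "0 \<le> ?x" "?x < real n" using assms by simp_all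
  show "?x = real (nat \<lfloor>?x\<rfloor>) + frac ?x" using x by (simp add: frac_def)
  show "nat \<lfloor>?x\<rfloor> < n" using x by linarith
qed (simp_all add: frac_lt_1)


section \<open>Isotopies of closed braids\<close>

lemma closed_braid_points_eq:
  "closed_braid_points w = {pt t q | t q. 0 \<le> t \<and> t < 1 \<and> q \<in> strands_at w t}"
  by (simp add: closed_braid_points_def pt_def)

lemma strands_at_disc: "q \<in> strands_at w t \<Longrightarrow> cmod q \<le> 1"
  using strands_at_bound[of q w t] by simp

lemma closed_braid_points_S3: "closed_braid_points w \<subseteq> S3"
  unfolding closed_braid_points_eq using pt_in_S3 strands_at_disc by blast

lemma Rep_closed_braid: "Rep_olink (closed_braid w) = loops_in (closed_braid_points w)"
  by (simp add: closed_braid.rep_eq closed_braid_components_eq)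

lemma closed_braid_isotopicI:
  fixes f :: "real \<Rightarrow> real" and F :: "real \<Rightarrow> real \<Rightarrow> complex \<Rightarrow> complex"
  assumes f: "circle_reparam f"
    and F: "\<And>s t. s \<in> {0..1} \<Longrightarrow> t \<in> {0..1} \<Longrightarrow> bij_betw (F s t) (cball 0 1) (cball 0 1)"
      "\<And>s q. F s 1 q = F s 0 q" "\<And>s t q. cmod q = 1 \<Longrightarrow> F s t q = q" "\<And>t q. F 0 t q = q"
      "continuous_on ({0..1} \<times> {0..1} \<times> cball 0 1) (\<lambda>(s, t, q). F s t q)"
    and strands: "\<And>t. 0 \<le> t \<Longrightarrow> t < 1 \<Longrightarrow> strands_at w (frac (f t)) = F 1 t ` strands_at v t"
  shows "isotopic (closed_braid v) (closed_braid w)"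
proof -
  define f' where "f' s t = (1 - s) * t + s * f t" for s t
  have f'_reparam: "circle_reparam (f' s)" if s: "s \<in> {0..1}" for s
  proof -
    have "strict_mono (f' s)"
    proof (rule strict_monoI)
      fix x y :: real assume "x < y"
      then have "f x < f y" using f by (simp add: circle_reparam_def strict_mono_def)
      then show "f' s x < f' s y" using s \<open>x < y\<close> unfolding f'_def
        by (cases "s = 0") (auto intro!: add_le_less_mono mult_left_mono)
    qed
    moreover have "continuous_on UNIV (f' s)"
      unfolding f'_def using f by (intro continuous_intros) (simp add: circle_reparam_def)
    moreover have "f' s (t + 1) = f' s t + 1" for t
    proof -
      have "f (t + 1) = f t + 1" using f unfolding circle_reparam_def by blast
      then show ?thesis unfolding f'_def by (simp only: distrib_left) (simp add: algebra_simps)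
    qed
    ultimately show ?thesis by (simp add: circle_reparam_def)
  qed
  have f'_cont: "continuous_on ({0..1} \<times> {0..1}) (\<lambda>(s, t). f' s t)"
  proof -
    have "continuous_on UNIV f" using f by (simp add: circle_reparam_def)
    then have "continuous_on ({0..1} \<times> {0..1}) (\<lambda>p :: real \<times> real. f (snd p))"
      by (rule continuous_on_compose2) (auto intro: continuous_intros)
    then show ?thesis unfolding split_beta f'_def by (intro continuous_intros)
  qed
  have f'0: "f' 0 t = t" for t by (simp add: f'_def)
  obtain H where H: "ambient_isotopy H"
    "\<And>t q. cmod q \<le> 1 \<Longrightarrow> H 1 (pt t q) = pt (f' 1 t) (F 1 (frac t) q)"
    "\<And>P. P \<subseteq> S3 \<Longrightarrow> map_link (H 1) (loops_in P) = loops_in (H 1 ` P)"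
    using polar_isotopy[of f' F, OF f'_reparam f'0 f'_cont F] by blast
  have H1: "H 1 (pt t q) = pt (frac (f t)) (F 1 t q)" if "0 \<le> t" "t < 1" "cmod q \<le> 1" for t q
    using H(2)[OF that(3), of t] that(1,2) by (simp add: f'_def frac_eq)
  have "H 1 ` closed_braid_points v = closed_braid_points w"
  proof (intro subset_antisym subsetI)
    fix x assume "x \<in> H 1 ` closed_braid_points v"
    then obtain t q where t: "0 \<le> t" "t < 1" "q \<in> strands_at v t" and x: "x = H 1 (pt t q)"
      unfolding closed_braid_points_eq by blast
    have "x = pt (frac (f t)) (F 1 t q)" using H1 t strands_at_disc x by blast
    moreover have "F 1 t q \<in> strands_at w (frac (f t))" using strands[OF t(1,2)] t(3) by blast
    ultimately show "x \<in> closed_braid_points w"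
      unfolding closed_braid_points_eq using frac_ge_0 frac_lt_1 by blast
  next
    fix x assume "x \<in> closed_braid_points w"
    then obtain t q where t: "0 \<le> t" "t < 1" "q \<in> strands_at w t" and x: "x = pt t q"
      unfolding closed_braid_points_eq by blast
    obtain g where g: "f \<circ> g = id" using f circle_reparam_inverse by metis
    define u where "u = frac (g t)"
    have u: "0 \<le> u" "u < 1" by (simp_all add: u_def frac_lt_1)
    have "f (u + of_int \<lfloor>g t\<rfloor>) = t" using g by (simp add: u_def frac_def) (metis comp_apply id_apply)
    then have "f u - t = of_int (- \<lfloor>g t\<rfloor>)"
      using circle_reparam_int[OF f, of u "\<lfloor>g t\<rfloor>"] by simp
    then have "f u - t \<in> \<int>" by (metis Ints_of_int)
    then have "frac (f u) = t" using t(1,2) by (simp add: frac_unique_iff)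
    then obtain q' where q': "q' \<in> strands_at v u" "q = F 1 u q'" using strands[OF u] t(3) by auto
    then have "x = H 1 (pt u q')" using H1[OF u strands_at_disc] x \<open>frac (f u) = t\<close> by metis
    then show "x \<in> H 1 ` closed_braid_points v"
      unfolding closed_braid_points_eq using u q'(1) by blast
  qed
  then show ?thesis
    using H(3)[OF closed_braid_points_S3, of v] by (intro isotopicI[OF H(1)]) (simp add: Rep_closed_braid)
qed

lemma closed_braid_rotate: "isotopic (closed_braid (w @ [x])) (closed_braid (x # w))"
proof (rule closed_braid_isotopicI[where f = "\<lambda>t. t + 1 / real (length (w @ [x]))" and F = "\<lambda>s t q. q"])
  let ?n = "length (w @ [x])"
  show "circle_reparam (\<lambda>t. t + 1 / real ?n)"
    unfolding circle_reparam_def by (auto simp: strict_mono_def intro!: continuous_intros)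
  show "continuous_on ({0..1} \<times> {0..1} \<times> cball 0 1) (\<lambda>(s :: real, t :: real, q :: complex). q)"
    unfolding split_beta by (intro continuous_intros)
  fix t :: real assume t: "0 \<le> t" "t < 1"
  obtain i r where i: "t * real ?n = real i + r" "0 \<le> r" "r < 1" "i < ?n"
    by (rule time_cases[OF t, of ?n]) auto
  have e: "(t + 1 / real ?n) * real ?n = real i + 1 + r" using i(1) by (simp add: field_simps)
  have v: "strands_at (w @ [x]) t = taper (fst ((w @ [x]) ! i)) (angle ((w @ [x]) ! i) * r) ` strand_base"
    by (rule strands_at_eq) (use i in auto)
  have "strands_at (x # w) (frac (t + 1 / real ?n)) = strands_at (w @ [x]) t"
  proof (cases "i < length w")
    case True
    have "(t + 1 / real ?n) * real ?n < 1 * real ?n" unfolding e using True i(3) by simp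
    then have "t + 1 / real ?n < 1" by (rule mult_right_less_imp_less) simp
    then have "frac (t + 1 / real ?n) = t + 1 / real ?n" using t by (simp add: frac_eq)
    moreover have "strands_at (x # w) (t + 1 / real ?n)
        = taper (fst ((x # w) ! (i + 1))) (angle ((x # w) ! (i + 1)) * r) ` strand_base"
      by (rule strands_at_eq) (use e i True in auto)
    ultimately show ?thesis using v True by (simp add: nth_append)
  next
    case False
    then have il: "i = length w" using i by simp
    then have e': "(t + 1 / real ?n - 1) * real ?n = r" using e by (simp add: algebra_simps)
    then have "0 \<le> (t + 1 / real ?n - 1) * real ?n" using i(2) by simp
    then have "0 \<le> t + 1 / real ?n - 1" by (simp add: zero_le_mult_iff)
    moreover have "1 / real ?n \<le> 1" by simp
    then have "t + 1 / real ?n - 1 < 1" using t by linarith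
    ultimately have "frac (t + 1 / real ?n) = t + 1 / real ?n - 1"
      by (simp add: frac_unique_iff)
    moreover have "strands_at (x # w) (t + 1 / real ?n - 1)
        = taper (fst ((x # w) ! 0)) (angle ((x # w) ! 0) * r) ` strand_base"
      by (rule strands_at_eq) (use e' i in auto)
    ultimately show ?thesis using v il by (simp add: nth_append)
  qed
  then show "strands_at (x # w) (frac (t + 1 / real ?n)) = (\<lambda>q. q) ` strands_at (w @ [x]) t"
    by simp
qed (auto simp: bij_betw_def)

lemma circle_reparam_extend:
  fixes f :: "real \<Rightarrow> real"
  assumes cont: "continuous_on {0..1} f" and mono: "strict_mono_on {0..1} f" and "f 0 = 0" "f 1 = 1"
  shows "circle_reparam (\<lambda>t. of_int \<lfloor>t\<rfloor> + f (frac t))"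
proof -
  define g where "g t = of_int \<lfloor>t\<rfloor> + f (frac t)" for t
  have g_eq: "g t = of_int k + f (t - of_int k)" if "t \<in> {of_int k..of_int k + 1}" for t k
  proof (cases "t = of_int k + 1")
    case True
    then have "t = of_int (k + 1)" by simp
    then show ?thesis unfolding g_def using assms(3,4) by (simp only: floor_of_int frac_of_int) simp
  next
    case False
    then have "\<lfloor>t\<rfloor> = k" using that by (simp add: floor_unique)
    then show ?thesis by (simp add: g_def frac_def)
  qed
  have c: "continuous_on {of_int k..of_int k + 1} g" for k
  proof -
    have "continuous_on {of_int k..of_int k + 1} (\<lambda>t. of_int k + f (t - of_int k))"
      by (intro continuous_intros continuous_on_compose2[OF cont]) auto
    then show ?thesis by (rule continuous_on_eq) (simp add: g_eq)
  qed
  have "isCont g t" for t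
  proof -
    define k where "k = \<lfloor>t + 1 / 2\<rfloor>"
    have "continuous_on ({of_int (k - 1)..of_int (k - 1) + 1} \<union> {of_int k..of_int k + 1}) g"
      by (intro continuous_on_closed_Un c) auto
    then have "continuous_on {of_int k - 1<..<of_int k + 1} g"
      by (rule continuous_on_subset) auto
    moreover have "t \<in> {of_int k - 1<..<of_int k + 1}"
      unfolding k_def by (auto; linarith)
    ultimately show ?thesis by (meson continuous_on_eq_continuous_at open_greaterThanLessThan)
  qed
  then have "continuous_on UNIV g" by (simp add: continuous_at_imp_continuous_on)
  moreover have "strict_mono g"
  proof (rule strict_monoI)
    fix x y :: real assume xy: "x < y"
    have fr: "frac x \<in> {0..1}" "frac y \<in> {0..1}" "frac x < 1" "frac y \<ge> 0"
      using frac_lt_1[of x] frac_lt_1[of y] by simp_all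
    show "g x < g y"
    proof (cases "\<lfloor>x\<rfloor> = \<lfloor>y\<rfloor>")
      case True
      then have "frac x < frac y" using xy by (simp add: frac_def)
      then have "f (frac x) < f (frac y)" using mono fr by (simp add: strict_mono_onD)
      then show ?thesis using True by (simp add: g_def)
    next
      case False
      then have "\<lfloor>x\<rfloor> + 1 \<le> \<lfloor>y\<rfloor>" using xy floor_mono[of x y] by linarith
      then have "(of_int \<lfloor>x\<rfloor> :: real) + 1 \<le> of_int \<lfloor>y\<rfloor>" by linarith
      moreover have "f (frac x) < f 1" using mono fr(1,3) by (intro strict_mono_onD[OF mono]) auto
      moreover have "f 0 \<le> f (frac y)"
      proof (cases "0 < frac y")
        case True
        then have "f 0 < f (frac y)" using fr(2) by (intro strict_mono_onD[OF mono]) auto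
        then show ?thesis by simp
      next
        case False
        then have "frac y = 0" using fr(4) by linarith
        then show ?thesis by (simp only: order_refl)
      qed
      ultimately show ?thesis using assms(3,4) by (simp add: g_def)
    qed
  qed
  moreover have "g (t + 1) = g t + 1" for t by (simp add: g_def frac_def)
  ultimately have "circle_reparam g" by (simp add: circle_reparam_def)
  then show ?thesis by (simp add: g_def[abs_def])
qed

lemma taper_image_add: "taper g a ` taper g b ` A = taper g (a + b) ` A"
  by (simp add: image_image taper_add)

text \<open>Time is rescaled so that the slot of the first letter y of the short word becomes the first three
  slots of the long one; m is the elapsed fraction of that slot. There B corrects the angle of y to
  zero for m up to 2/3, and A adds a twist forth and back.\<close>

lemma closed_braid_cancel:
  "isotopic (closed_braid (y # w)) (closed_braid ((g, e) # (g, \<not> e) # y # w))"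
proof -
  let ?v = "y # w" and ?w = "(g, e) # (g, \<not> e) # y # w"
  define n where "n = real (length ?v)"
  define m where "m t = min 1 (n * t)" for t
  define f where "f t = (n * t + 2 * m t) / (n + 2)" for t
  define f' where "f' t = of_int \<lfloor>t\<rfloor> + f (frac t)" for t
  define A where "A t = angle (g, e) * max 0 (min (3 * m t) (2 - 3 * m t))" for t
  define B where "B t = angle y * (max 0 (3 * m t - 2) - m t)" for t
  define F where "F s t q = taper g (s * A t) (taper (fst y) (s * B t) q)" for s t q
  have n: "n \<ge> 1" "real (length ?w) = n + 2" by (simp_all add: n_def)
  have m01: "m 0 = 0" "m 1 = 1" using n by (simp_all add: m_def)
  have m_cont: "continuous_on S m" for S unfolding m_def[abs_def] by (intro continuous_intros)
  have AB_cont: "continuous_on S A" "continuous_on S B" for S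
    unfolding A_def[abs_def] B_def[abs_def] by (intro continuous_intros m_cont)+
  have AB01: "A 0 = 0" "A 1 = 0" "B 0 = 0" "B 1 = 0" by (simp_all add: A_def B_def m01)
  have "circle_reparam f'"
    unfolding f'_def[abs_def]
  proof (rule circle_reparam_extend)
    show "continuous_on {0..1} f"
      unfolding f_def[abs_def] using n by (intro continuous_intros m_cont) auto
    show "strict_mono_on {0..1} f"
    proof (rule strict_mono_onI)
      fix x y :: real assume "x < y"
      then have "n * x < n * y" using n by simp
      then have "n * x + 2 * m x < n * y + 2 * m y" by (simp add: m_def)
      then show "f x < f y" unfolding f_def using n by (intro divide_strict_right_mono) auto
    qed
    show "f 0 = 0" "f 1 = 1" using n by (simp_all add: f_def m01)
  qed
  then show ?thesis
  proof (rule closed_braid_isotopicI[where F = F])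
    show "bij_betw (F s t) (cball 0 1) (cball 0 1)" for s t
      unfolding F_def[abs_def]
      using bij_betw_trans[OF bij_betw_taper[of "fst y" "s * B t"] bij_betw_taper[of g "s * A t"]]
      by (simp add: comp_def)
    show "F s 1 q = F s 0 q" for s q by (simp add: F_def AB01)
    show "F s t q = q" if "cmod q = 1" for s t q using that by (simp add: F_def taper_boundary)
    show "F 0 t q = q" for t q by (simp add: F_def)
    have "continuous_on ({0..1} \<times> {0..1} \<times> cball 0 1) (\<lambda>p :: real \<times> real \<times> complex. A (fst (snd p)))"
      "continuous_on ({0..1} \<times> {0..1} \<times> cball 0 1) (\<lambda>p :: real \<times> real \<times> complex. B (fst (snd p)))"
      by (rule continuous_on_compose2[OF AB_cont(1)[of UNIV]] continuous_on_compose2[OF AB_cont(2)[of UNIV]];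
          auto intro!: continuous_intros)+
    then show "continuous_on ({0..1} \<times> {0..1} \<times> cball 0 1) (\<lambda>(s, t, q). F s t q)"
      unfolding split_beta F_def by (intro continuous_intros)
  next
    fix t :: real assume t: "0 \<le> t" "t < 1"
    have nt: "0 \<le> n * t" using n t by simp
    have ft: "f t * real (length ?w) = n * t + 2 * m t" unfolding n(2) f_def using n(1) by simp
    have "n * t + 2 * m t < 1 * (n + 2)"
    proof -
      have "n * t < n" using n t by simp
      moreover have "m t \<le> 1" by (simp add: m_def)
      ultimately show ?thesis by simp
    qed
    then have "f t < 1" unfolding f_def using n by (simp add: divide_less_eq)
    moreover have "0 \<le> f t" using nt n by (simp add: f_def m_def)
    ultimately have f': "frac (f' t) = f t" using t by (simp add: f'_def frac_eq floor_eq_iff frac_unique_iff)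
    have nl: "t * real (length ?v) = n * t" by (simp add: n_def)
    have F1: "F 1 t ` S = taper g (A t) ` taper (fst y) (B t) ` S" for S by (simp add: F_def image_image)
    show "strands_at ?w (frac (f' t)) = F 1 t ` strands_at ?v t"
    proof (cases "n * t < 1")
      case True
      then have m: "m t = n * t" "0 \<le> m t" "m t < 1" using nt by (simp_all add: m_def)
      have v: "strands_at ?v t = taper (fst y) (angle y * m t) ` strand_base"
        using strands_at_eq[of t ?v 0 "m t"] nl m by simp
      have Fv: "F 1 t ` strands_at ?v t
          = taper g (A t) ` taper (fst y) (angle y * max 0 (3 * m t - 2)) ` strand_base"
        unfolding F1 v taper_image_add by (simp add: B_def algebra_simps)
      have ft3: "f t * real (length ?w) = 3 * m t" using ft m(1) by simp
      consider "3 * m t < 1" | "1 \<le> 3 * m t" "3 * m t < 2" | "2 \<le> 3 * m t" by linarith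
      then show ?thesis
      proof cases
        case 1
        then have "A t = angle (g, e) * (3 * m t)" using m(2) by (simp add: A_def)
        then show ?thesis
          unfolding Fv f' using strands_at_eq[of "f t" ?w 0 "3 * m t"] ft3 1 m(2) by simp
      next
        case 2
        have a: "angle (g, \<not> e) = - angle (g, e)" by (simp add: angle_def)
        have "A t = angle (g, e) * (2 - 3 * m t)" using 2 by (simp add: A_def)
        also have "\<dots> = angle (g, \<not> e) * (3 * m t - 1) + angle (g, e)"
          unfolding a by (simp add: algebra_simps)
        finally have "A t = angle (g, \<not> e) * (3 * m t - 1) + angle (g, e)" .
        then have "taper g (A t) ` strand_base = taper g (angle (g, \<not> e) * (3 * m t - 1)) ` strand_base"
          using taper_angle_base[of "(g, e)"] by (simp flip: taper_image_add)
        then show ?thesis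
          unfolding Fv f' using strands_at_eq[of "f t" ?w 1 "3 * m t - 1"] ft3 2 by simp
      next
        case 3
        then have "A t = 0" by (simp add: A_def)
        then show ?thesis
          unfolding Fv f' using strands_at_eq[of "f t" ?w 2 "3 * m t - 2"] ft3 3 m(3) by simp
      qed
    next
      case False
      then have m: "m t = 1" by (simp add: m_def)
      then have AB: "A t = 0" "B t = 0" by (simp_all add: A_def B_def)
      obtain i r where i: "t * real (length ?v) = real i + r" "0 \<le> r" "r < 1" "i < length ?v"
        by (rule time_cases[OF t, of "length ?v"]) auto
      have "f t * real (length ?w) = real (i + 2) + r" using ft m i(1) nl by simp
      then have "strands_at ?w (f t) = strands_at ?v t"
        using strands_at_eq[of "f t" ?w "i + 2" r] strands_at_eq[OF i(1-3)] i(2-4) by simp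
      then show ?thesis unfolding f' F1 by (simp add: AB)
    qed
  qed
qed


section \<open>Mirror images and reversals of closed braids\<close>

definition flip :: "braid_word \<Rightarrow> braid_word" where
  "flip w = map (\<lambda>(x, e). (x, \<not> e)) w"

lemma length_flip [simp]: "length (flip w) = length w"
  by (simp add: flip_def)

lemma flip_flip [simp]: "flip (flip w) = w"
  by (simp add: flip_def comp_def split_beta)

lemma strands_at_flip:
  assumes "0 \<le> t" "t < 1"
  shows "strands_at (flip w) t = cnj ` strands_at w t"
proof (cases "w = []")
  case True
  then show ?thesis by (simp add: flip_def strands_at_def cnj_base)
next
  case False
  then obtain i r where i: "t * real (length w) = real i + r" "0 \<le> r" "r < 1" "i < length w"
    using time_cases[OF assms, of "length w"] by blast
  have l: "fst (flip w ! i) = fst (w ! i)" "angle (flip w ! i) = - angle (w ! i)"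
    using i(4) by (simp_all add: flip_def angle_def split_beta)
  show ?thesis
    using strands_at_eq[of t "flip w" i r] strands_at_eq[OF i] i l by (simp add: cnj_taper_base)
qed

lemma reflection_pt: "reflection (pt t q) = pt t (cnj q)"
  by (simp add: reflection_def pt_def)

lemma mirror_closed_braid: "mirror (closed_braid w) = closed_braid (flip w)"
proof -
  have "winding_map reflection"
    unfolding winding_map_def reflection_pt by (intro exI[of _ id]) (auto simp: strict_mono_def)
  then have "map_link reflection (loops_in (closed_braid_points w))
      = loops_in (reflection ` closed_braid_points w)"
    using map_loops_in[OF homeomorphism_reflection _ _ closed_braid_points_S3] by blast
  also have "reflection ` closed_braid_points w = closed_braid_points (flip w)"
  proof (intro subset_antisym subsetI)
    fix x assume "x \<in> reflection ` closed_braid_points w"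
    then show "x \<in> closed_braid_points (flip w)"
      unfolding closed_braid_points_eq using reflection_pt strands_at_flip by blast
  next
    fix x assume "x \<in> closed_braid_points (flip w)"
    then obtain t p where t: "0 \<le> t" "t < 1" "p \<in> strands_at (flip w) t" "x = pt t p"
      unfolding closed_braid_points_eq by blast
    then obtain q where "q \<in> strands_at w t" "p = cnj q" using strands_at_flip by auto
    then have "x = reflection (pt t q)" "pt t q \<in> closed_braid_points w"
      using t unfolding closed_braid_points_eq reflection_pt by blast+
    then show "x \<in> reflection ` closed_braid_points w" by (rule image_eqI)
  qed
  finally show ?thesis
    by (simp flip: Rep_olink_inject add: mirror.rep_eq Rep_closed_braid)
qed

definition turn_over :: "real \<Rightarrow> complex \<times> complex \<Rightarrow> complex \<times> complex" where
  "turn_over s x = (Complex (Re (fst x)) (cos (pi * s) * Im (fst x) - sin (pi * s) * Im (snd x)),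
                    Complex (Re (snd x)) (sin (pi * s) * Im (fst x) + cos (pi * s) * Im (snd x)))"

lemma turn_over_1: "turn_over 1 x = (cnj (fst x), cnj (snd x))"
  by (simp add: turn_over_def complex_eq_iff)

lemma turn_over_inverse: "turn_over (- s) (turn_over s x) = x"
proof -
  let ?c = "cos (pi * s)" and ?s = "sin (pi * s)"
  have *: "?c * ?c + ?s * ?s = 1" using sin_cos_squared_add3[of "pi * s"] by (simp add: power2_eq_square)
  have "?c * (?c * a - ?s * b) + ?s * (?s * a + ?c * b) = a"
    "- ?s * (?c * a - ?s * b) + ?c * (?s * a + ?c * b) = b" for a b :: real
  proof -
    have "?c * (?c * a - ?s * b) + ?s * (?s * a + ?c * b) = (?c * ?c + ?s * ?s) * a"
      "- ?s * (?c * a - ?s * b) + ?c * (?s * a + ?c * b) = (?c * ?c + ?s * ?s) * b"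
      by (simp_all only: algebra_simps)
    then show "?c * (?c * a - ?s * b) + ?s * (?s * a + ?c * b) = a"
      "- ?s * (?c * a - ?s * b) + ?c * (?s * a + ?c * b) = b" by (simp_all only: * mult_1_left)
  qed
  note rot = this
  show ?thesis using rot[of "Im (fst x)" "Im (snd x)"]
    by (simp add: turn_over_def prod_eq_iff complex_eq_iff)
qed

lemma turn_over_S3: "x \<in> S3 \<Longrightarrow> turn_over s x \<in> S3"
proof -
  assume "x \<in> S3"
  let ?c = "cos (pi * s)" and ?s = "sin (pi * s)"
  have *: "?c\<^sup>2 + ?s\<^sup>2 = 1" by simp
  have "(c * a - d * b)\<^sup>2 + (d * a + c * b)\<^sup>2 = (c\<^sup>2 + d\<^sup>2) * (a\<^sup>2 + b\<^sup>2)" for a b c d :: real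
    by (simp add: power2_eq_square algebra_simps)
  from this[of ?c "Im (fst x)" ?s "Im (snd x)"]
  have "(cmod (fst (turn_over s x)))\<^sup>2 + (cmod (snd (turn_over s x)))\<^sup>2
      = (cmod (fst x))\<^sup>2 + (cmod (snd x))\<^sup>2"
    unfolding * by (simp add: turn_over_def cmod_power2)
  then show ?thesis using S3_norms[OF \<open>x \<in> S3\<close>] by (simp add: S3_def norm_prod_def)
qed

lemma continuous_on_turn_over: "continuous_on A (\<lambda>(s, x). turn_over s x)"
  unfolding turn_over_def split_beta Complex_eq by (intro continuous_intros)

lemma homeomorphism_turn_over: "homeomorphism S3 S3 (turn_over s) (turn_over (- s))"
proof -
  have c: "continuous_on S3 (turn_over s)" for s
    unfolding turn_over_def Complex_eq by (intro continuous_intros)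
  have inv: "turn_over s (turn_over (- s) x) = x" for s x using turn_over_inverse[of "- s" x] by simp
  have "turn_over s ` S3 = S3" for s
  proof (intro subset_antisym subsetI)
    fix x assume "x \<in> S3"
    then show "x \<in> turn_over s ` S3"
      using inv[of s x] turn_over_S3[of x "- s"] by (metis imageI)
  qed (use turn_over_S3 in blast)
  then show ?thesis
    unfolding homeomorphism_def using c turn_over_inverse inv by blast
qed

lemma ambient_isotopy_turn_over: "ambient_isotopy turn_over"
  unfolding ambient_isotopy_def
proof (intro conjI ballI)
  show "continuous_on ({0..1} \<times> S3) (\<lambda>(s, x). turn_over s x)" by (rule continuous_on_turn_over)
  show "\<exists>g. homeomorphism S3 S3 (turn_over s) g" for s using homeomorphism_turn_over by blast
  show "turn_over 0 x = x" for x by (simp add: turn_over_def)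
qed

lemma turn_over_pt: "turn_over 1 (pt t q) = pt (- t) (cnj q)"
  by (simp add: turn_over_1 pt_def cis_cnj)

lemma reverse_loops_in_subset:
  "map_link (turn_over 1) (reverse_link (loops_in P)) \<subseteq> loops_in (turn_over 1 ` P)"
proof
  fix K assume "K \<in> map_link (turn_over 1) (reverse_link (loops_in P))"
  then obtain \<gamma> where g: "simple_loop \<gamma>" "range \<gamma> \<subseteq> P" "winds_positively \<gamma>"
    "K = (\<lambda>\<gamma>. turn_over 1 \<circ> \<gamma>) ` (\<lambda>\<gamma> t. \<gamma> (- t)) ` oriented_knot \<gamma>"
    unfolding map_link_def reverse_link_def loops_in_def by blast
  let ?d = "turn_over 1 \<circ> (\<lambda>t. \<gamma> (- t))"
  have h: "continuous_on S3 (turn_over 1)" "turn_over 1 ` S3 \<subseteq> S3" "inj_on (turn_over 1) S3"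
    using homeomorphism_turn_over[of 1] unfolding homeomorphism_def by (auto intro: inj_on_inverseI)
  have d: "simple_loop ?d" using simple_loop_map[OF simple_loop_reverse[OF g(1)] h] .
  have "range \<gamma> \<subseteq> S3" using g(1) by (simp add: simple_loop_def)
  from winds_positively_pt_iff[OF this]
  obtain \<phi> where p: "continuous_on UNIV \<phi>" "strict_mono \<phi>" "\<And>u. \<gamma> u = pt (\<phi> u) (snd (\<gamma> u))"
    using g(3) by blast
  have "continuous_on UNIV (\<lambda>u. - \<phi> (- u))"
    by (intro continuous_intros continuous_on_compose2[OF p(1)]) auto
  moreover have "strict_mono (\<lambda>u. - \<phi> (- u))" using p(2) by (simp add: strict_mono_def)
  moreover have "?d u = pt (- \<phi> (- u)) (snd (?d u))" for u
  proof -
    have "?d u = pt (- \<phi> (- u)) (cnj (snd (\<gamma> (- u))))"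
      using p(3)[of "- u"] turn_over_pt by (metis comp_apply)
    then show ?thesis by simp
  qed
  moreover have "range ?d \<subseteq> S3" using d by (simp only: simple_loop_def)
  ultimately have "winds_positively ?d"
    by (intro winds_positively_pt_iff[THEN iffD2]) blast+
  moreover have "range ?d \<subseteq> turn_over 1 ` P" using g(2) by auto
  ultimately show "K \<in> loops_in (turn_over 1 ` P)"
    using d unfolding g(4) reverse_oriented_knot map_oriented_knot loops_in_def by blast
qed

lemma turn_over_1_1: "turn_over 1 (turn_over 1 x) = x"
  by (simp add: turn_over_1)

lemma reverse_loops_in:
  "map_link (turn_over 1) (reverse_link (loops_in P)) = loops_in (turn_over 1 ` P)"
proof (rule subset_antisym[OF reverse_loops_in_subset])
  have tt: "turn_over 1 ` turn_over 1 ` P = P" by (simp add: image_image turn_over_1_1)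
  have "map_link (turn_over 1) (reverse_link (map_link (turn_over 1) (reverse_link L))) = L" for L
    by (simp add: map_link_def reverse_link_def image_image comp_def turn_over_1_1)
  note invol = this[of "loops_in (turn_over 1 ` P)"]
  have mono: "map_link (turn_over 1) (reverse_link L) \<subseteq> map_link (turn_over 1) (reverse_link L')"
    if "L \<subseteq> L'" for L L' using that unfolding map_link_def reverse_link_def by blast
  have "map_link (turn_over 1) (reverse_link (loops_in (turn_over 1 ` P))) \<subseteq> loops_in P"
    using reverse_loops_in_subset[of "turn_over 1 ` P"] unfolding tt .
  from mono[OF this] show "loops_in (turn_over 1 ` P) \<subseteq> map_link (turn_over 1) (reverse_link (loops_in P))"
    unfolding invol .
qed

lemma strands_at_rev:
  assumes "0 \<le> t" "t < 1"
  shows "strands_at (rev w) (frac (- t)) = cnj ` strands_at w t"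
proof (cases "w = [] \<or> t = 0")
  case True
  moreover have "strands_at v 0 = strand_base" for v
    using strands_at_Ints[of 0 v 0] by (cases "v = []") (auto simp: strands_at_def)
  moreover have "strands_at [] u = strand_base" for u by (simp add: strands_at_def)
  ultimately show ?thesis by (elim disjE) (simp_all add: cnj_base)
next
  case False
  then obtain i r where i: "t * real (length w) = real i + r" "0 \<le> r" "r < 1" "i < length w"
    using time_cases[OF assms, of "length w"] by blast
  let ?j = "length w - 1 - i"
  have fr: "frac (- t) = 1 - t" using False assms by (simp add: frac_unique_iff)
  have e: "(1 - t) * real (length (rev w)) = real ?j + (1 - r)"
    using i by (simp add: algebra_simps of_nat_diff)
  have l: "rev w ! ?j = w ! i" using i(4) by (simp add: rev_nth)
  have "strands_at (rev w) (1 - t) = taper (fst (w ! i)) (angle (w ! i) * (1 - r)) ` strand_base"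
    using strands_at_eq_closed[OF e] i False assms l by simp
  also have "angle (w ! i) * (1 - r) = - (angle (w ! i) * r) + angle (w ! i)"
    by (simp add: algebra_simps)
  also have "taper (fst (w ! i)) \<dots> ` strand_base = cnj ` strands_at w t"
    unfolding strands_at_eq[OF i] cnj_taper_base taper_image_add[symmetric] taper_angle_base ..
  finally show ?thesis unfolding fr .
qed

lemma turn_over_closed_braid_points: "turn_over 1 ` closed_braid_points w = closed_braid_points (rev w)"
proof -
  have sub: "turn_over 1 ` closed_braid_points w \<subseteq> closed_braid_points (rev w)" for w
  proof
    fix x assume "x \<in> turn_over 1 ` closed_braid_points w"
    then obtain t q where t: "0 \<le> t" "t < 1" "q \<in> strands_at w t" "x = turn_over 1 (pt t q)"
      unfolding closed_braid_points_eq by blast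
    then have "x = pt (frac (- t)) (cnj q)" by (simp add: turn_over_pt)
    moreover have "cnj q \<in> strands_at (rev w) (frac (- t))" using strands_at_rev t by blast
    ultimately show "x \<in> closed_braid_points (rev w)"
      unfolding closed_braid_points_eq using frac_ge_0 frac_lt_1 by blast
  qed
  have "closed_braid_points (rev w) = turn_over 1 ` turn_over 1 ` closed_braid_points (rev w)"
    by (simp add: image_image turn_over_1_1)
  also have "\<dots> \<subseteq> turn_over 1 ` closed_braid_points w" using sub[of "rev w"] by auto
  finally show ?thesis using sub by blast
qed

lemma reverse_closed_braid: "isotopic (reverse (closed_braid w)) (closed_braid (rev w))"
  by (rule isotopicI[OF ambient_isotopy_turn_over])
    (simp add: reverse.rep_eq Rep_closed_braid reverse_loops_in turn_over_closed_braid_points)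

section \<open>Closures of conjugate braids\<close>

lemma B3_simps [simp]: "x \<in> carrier B3" "\<one>\<^bsub>B3\<^esub> = braid_of []"
  by (simp_all add: B3_def)

lemma braid_of_append: "braid_of (u @ v) = braid_of u \<otimes>\<^bsub>B3\<^esub> braid_of v"
  by (simp add: B3_def braid_mult.abs_eq)

lemma braid_of_eq_iff: "braid_of u = braid_of v \<longleftrightarrow> equivclp braid_step u v"
  by (rule braid.abs_eq_iff)

lemma word_inv_eq: "word_inv w = rev (flip w)"
  by (simp add: word_inv_def flip_def)

lemma braid_of_word_inv: "braid_of (word_inv w) = inv\<^bsub>B3\<^esub> braid_of w"
proof -
  have "braid_of (word_inv w) \<otimes>\<^bsub>B3\<^esub> braid_of w = \<one>\<^bsub>B3\<^esub>"
    by (simp add: braid_of_eq_iff word_inv_append flip: braid_of_append)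
  then show ?thesis using group.inv_equality[OF group_B3] by simp
qed

lemma braid_of_context:
  "braid_of u = braid_of v \<Longrightarrow> braid_of (x @ u @ y) = braid_of (x @ v @ y)"
  by (simp add: braid_of_append)

lemma braid_of_cancel: "braid_of (u @ (x, e) # (x, \<not> e) # v) = braid_of (u @ v)"
  unfolding braid_of_eq_iff using braid_step.cancel[of u x e v] by (simp add: r_into_equivclp)

lemma braid_of_cancel_word:
  "braid_of (u @ w @ word_inv w @ v) = braid_of (u @ v)" "braid_of (u @ word_inv w @ w @ v) = braid_of (u @ v)"
proof -
  interpret group B3 by (rule group_B3)
  show "braid_of (u @ w @ word_inv w @ v) = braid_of (u @ v)" "braid_of (u @ word_inv w @ w @ v) = braid_of (u @ v)"
    by (simp_all add: braid_of_append braid_of_word_inv m_assoc[symmetric])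
qed

lemma equivclp_braid_step_map:
  assumes "\<And>u v. braid_step u v \<Longrightarrow> braid_step (h u) (h v)" "equivclp braid_step u v"
  shows "equivclp braid_step (h u) (h v)"
  using assms(2)
proof (induction rule: equivclp_induct)
  case (step v w)
  then show ?case using assms(1) by (meson equivclp_into_equivclp)
qed (rule equivclp_refl)

lemma braid_step_rev: "braid_step u v \<Longrightarrow> braid_step (rev u) (rev v)"
proof (induction rule: braid_step.induct)
  case (cancel u x e v)
  show ?case using braid_step.cancel[of "rev v" x "\<not> e" "rev u"] by simp
next
  case (artin u v)
  show ?case using braid_step.artin[of "rev v" "rev u"] by simp
qed

lemma braid_of_rev_cong: "braid_of u = braid_of v \<Longrightarrow> braid_of (rev u) = braid_of (rev v)"
  unfolding braid_of_eq_iff using equivclp_braid_step_map[of rev] braid_step_rev by blast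

lemma braid_of_flip_cong:
  assumes "braid_of u = braid_of v"
  shows "braid_of (flip u) = braid_of (flip v)"
proof -
  have "braid_of (rev (word_inv u)) = braid_of (rev (word_inv v))"
    by (intro braid_of_rev_cong) (simp add: braid_of_word_inv assms)
  then show ?thesis by (simp add: word_inv_eq)
qed

lemma braid_closureI: "braid_of w = \<beta> \<Longrightarrow> isotopic (closed_braid w) L \<Longrightarrow> L \<in> braid_closure \<beta>"
  unfolding braid_closure_def by blast

lemma braid_closureE:
  assumes "L \<in> braid_closure \<beta>"
  obtains w where "braid_of w = \<beta>" "isotopic (closed_braid w) L"
  using assms unfolding braid_closure_def by blast

lemma mirror_braid_closure: "mirror ` braid_closure (braid_of w) = braid_closure (braid_of (flip w))"
proof -
  have sub: "mirror L \<in> braid_closure (braid_of (flip w))" if L: "L \<in> braid_closure (braid_of w)" for L w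
    using L
  proof (rule braid_closureE)
    fix v assume "braid_of v = braid_of w" "isotopic (closed_braid v) L"
    then show ?thesis
      by (metis braid_closureI braid_of_flip_cong isotopic_mirror mirror_closed_braid)
  qed
  show ?thesis
  proof (intro subset_antisym subsetI)
    fix L assume "L \<in> braid_closure (braid_of (flip w))"
    then have "mirror L \<in> braid_closure (braid_of w)" using sub[of L "flip w"] by simp
    moreover have "L = mirror (mirror L)" using mirror_mirror by (metis comp_apply id_apply)
    ultimately show "L \<in> mirror ` braid_closure (braid_of w)" by blast
  qed (use sub in blast)
qed

lemma reverse_braid_closure: "reverse ` braid_closure (braid_of w) = braid_closure (braid_of (rev w))"
proof -
  have sub: "reverse L \<in> braid_closure (braid_of (rev w))" if L: "L \<in> braid_closure (braid_of w)" for L w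
    using L
  proof (rule braid_closureE)
    fix v assume v: "braid_of v = braid_of w" "isotopic (closed_braid v) L"
    have "isotopic (closed_braid (rev v)) (reverse L)"
      using isotopic_sym[OF reverse_closed_braid] isotopic_reverse[OF v(2)] by (rule isotopic_trans)
    then show ?thesis by (rule braid_closureI[OF braid_of_rev_cong[OF v(1)]])
  qed
  show ?thesis
  proof (intro subset_antisym subsetI)
    fix L assume "L \<in> braid_closure (braid_of (rev w))"
    then have "reverse L \<in> braid_closure (braid_of w)" using sub[of L "rev w"] by simp
    moreover have "L = reverse (reverse L)" using reverse_reverse by (metis comp_apply id_apply)
    ultimately show "L \<in> reverse ` braid_closure (braid_of w)" by blast
  qed (use sub in blast)
qed

lemma closed_braid_conjugate_letter:
  assumes "w \<noteq> []"
  shows "isotopic (closed_braid w) (closed_braid ((x, e) # w @ [(x, \<not> e)]))"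
proof -
  obtain y v where w: "w = y # v" using assms by (cases w) auto
  have "isotopic (closed_braid w) (closed_braid ((x, \<not> e) # (x, e) # w))"
    using closed_braid_cancel[of y v x "\<not> e"] by (simp add: w)
  moreover have "isotopic (closed_braid ((x, \<not> e) # (x, e) # w)) (closed_braid ((x, e) # w @ [(x, \<not> e)]))"
    using isotopic_sym[OF closed_braid_rotate[of "(x, e) # w" "(x, \<not> e)"]] by simp
  ultimately show ?thesis by (rule isotopic_trans)
qed

lemma braid_closure_conjugate_letter_subset:
  "braid_closure (braid_of w) \<subseteq> braid_closure (braid_of ((x, e) # w @ [(x, \<not> e)]))"
proof
  fix L assume "L \<in> braid_closure (braid_of w)"
  then obtain v where v: "braid_of v = braid_of w" "isotopic (closed_braid v) L" by (rule braid_closureE)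
  have eq: "braid_of ((x, e) # v @ [(x, \<not> e)]) = braid_of ((x, e) # w @ [(x, \<not> e)])"
    using braid_of_context[OF v(1), of "[(x, e)]" "[(x, \<not> e)]"] by simp
  show "L \<in> braid_closure (braid_of ((x, e) # w @ [(x, \<not> e)]))"
  proof (cases "v = []")
    case True
    then have "braid_of ((x, e) # w @ [(x, \<not> e)]) = braid_of v"
      using eq braid_of_cancel[of "[]" x e "[]"] by simp
    then show ?thesis using v(2) by (intro braid_closureI) auto
  next
    case False
    have "isotopic (closed_braid ((x, e) # v @ [(x, \<not> e)])) L"
      using isotopic_sym[OF closed_braid_conjugate_letter[OF False]] v(2) by (rule isotopic_trans)
    then show ?thesis by (rule braid_closureI[OF eq])
  qed
qed

lemma braid_closure_rotate1: "braid_closure (braid_of (x # w)) = braid_closure (braid_of (w @ [x]))"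
proof
  obtain g e where x: "x = (g, e)" by force
  have "braid_of ((g, \<not> e) # (x # w) @ [(g, e)]) = braid_of (w @ [x])"
    using braid_of_cancel[of "[]" g "\<not> e" "w @ [x]"] by (simp add: x)
  then show "braid_closure (braid_of (x # w)) \<subseteq> braid_closure (braid_of (w @ [x]))"
    using braid_closure_conjugate_letter_subset[of "x # w" g "\<not> e"] by simp
  have "braid_of ((g, e) # (w @ [x]) @ [(g, \<not> e)]) = braid_of (x # w)"
    using braid_of_cancel[of "x # w" g e "[]"] by (simp add: x)
  then show "braid_closure (braid_of (w @ [x])) \<subseteq> braid_closure (braid_of (x # w))"
    using braid_closure_conjugate_letter_subset[of "w @ [x]" g e] by simp
qed

lemma braid_closure_commute: "braid_closure (braid_of (u @ v)) = braid_closure (braid_of (v @ u))"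
proof (induction u arbitrary: v)
  case (Cons x u)
  then show ?case using braid_closure_rotate1[of x "u @ v"] Cons.IH[of "v @ [x]"] by simp
qed simp

lemma conjugate_commute: "conjugate_in_B3 (braid_of (v @ u)) (braid_of (u @ v))"
proof -
  interpret group B3 by (rule group_B3)
  have "braid_of (v @ u) = braid_of v \<otimes>\<^bsub>B3\<^esub> braid_of (u @ v) \<otimes>\<^bsub>B3\<^esub> inv\<^bsub>B3\<^esub> braid_of v"
    by (simp add: braid_of_append m_assoc flip: B3_simps(2))
  then show ?thesis unfolding conjugate_in_B3_def by (intro bexI[of _ "braid_of v"]) simp_all
qed

lemma conjugate_refl: "conjugate_in_B3 x x"
proof -
  interpret group B3 by (rule group_B3)
  have "x = \<one>\<^bsub>B3\<^esub> \<otimes>\<^bsub>B3\<^esub> x \<otimes>\<^bsub>B3\<^esub> inv\<^bsub>B3\<^esub> \<one>\<^bsub>B3\<^esub>" by (simp del: B3_simps(2))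
  then show ?thesis unfolding conjugate_in_B3_def by (intro bexI[of _ "\<one>\<^bsub>B3\<^esub>"]) simp_all
qed

lemma conjugate_trans:
  assumes "conjugate_in_B3 x y" "conjugate_in_B3 y z"
  shows "conjugate_in_B3 x z"
proof -
  interpret group B3 by (rule group_B3)
  obtain g h where "x = g \<otimes>\<^bsub>B3\<^esub> y \<otimes>\<^bsub>B3\<^esub> inv\<^bsub>B3\<^esub> g" "y = h \<otimes>\<^bsub>B3\<^esub> z \<otimes>\<^bsub>B3\<^esub> inv\<^bsub>B3\<^esub> h"
    using assms unfolding conjugate_in_B3_def by blast
  then have "x = (g \<otimes>\<^bsub>B3\<^esub> h) \<otimes>\<^bsub>B3\<^esub> z \<otimes>\<^bsub>B3\<^esub> inv\<^bsub>B3\<^esub> (g \<otimes>\<^bsub>B3\<^esub> h)"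
    by (simp add: m_assoc inv_mult_group)
  then show ?thesis unfolding conjugate_in_B3_def by (intro bexI[of _ "g \<otimes>\<^bsub>B3\<^esub> h"]) simp_all
qed

fun other :: "braid_gen \<Rightarrow> braid_gen" where
  "other Sigma1 = Sigma2"
| "other Sigma2 = Sigma1"

lemma other_other [simp]: "other (other g) = g"
  by (cases g) simp_all

definition half_turn :: braid_word where
  "half_turn = [(Sigma1, True), (Sigma2, True), (Sigma1, True)]"

lemma half_turn_letter: "braid_of (half_turn @ [(g, e)]) = braid_of ((other g, e) # half_turn)"
proof -
  have art: "braid_of (u @ [(Sigma1, True), (Sigma2, True), (Sigma1, True)] @ v)
           = braid_of (u @ [(Sigma2, True), (Sigma1, True), (Sigma2, True)] @ v)" for u v
    unfolding braid_of_eq_iff by (intro r_into_equivclp braid_step.artin)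
  have pos: "braid_of (half_turn @ [(g, True)]) = braid_of ((other g, True) # half_turn)" for g
    using art[of "[]" "[(Sigma1, True)]"] art[of "[(Sigma1, True)]" "[]"] by (cases g) (simp_all add: half_turn_def)
  show ?thesis
  proof (cases e)
    case False
    have "braid_of ((other g, False) # half_turn) = braid_of ((other g, False) # half_turn @ [(g, True), (g, False)])"
      using braid_of_cancel[of "(other g, False) # half_turn" g True "[]"] by simp
    also have "\<dots> = braid_of ((other g, False) # (other g, True) # half_turn @ [(g, False)])"
      using braid_of_context[OF pos, of "[(other g, False)]" g "[(g, False)]"] by simp
    also have "\<dots> = braid_of (half_turn @ [(g, False)])"
      using braid_of_cancel[of "[]" "other g" False "half_turn @ [(g, False)]"] by simp
    finally show ?thesis using False by simp
  qed (use pos in simp)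
qed

lemma half_turn_word: "braid_of (half_turn @ w) = braid_of (map (apfst other) w @ half_turn)"
proof (induction w)
  case (Cons x w)
  obtain g e where x: "x = (g, e)" by force
  have "braid_of (half_turn @ x # w) = braid_of ((other g, e) # half_turn @ w)"
    using braid_of_context[OF half_turn_letter[of g e], of "[]" w] by (simp add: x)
  also have "\<dots> = braid_of ((other g, e) # map (apfst other) w @ half_turn)"
    using braid_of_context[OF Cons.IH, of "[(other g, e)]" "[]"] by simp
  finally show ?case by (simp add: x)
qed simp

lemma braid_closure_swap: "braid_closure (braid_of (map (apfst other) w)) = braid_closure (braid_of w)"
proof -
  have "braid_closure (braid_of (map (apfst other) w))
      = braid_closure (braid_of (map (apfst other) w @ half_turn @ word_inv half_turn))"
    using braid_of_cancel_word(1)[of "map (apfst other) w" half_turn "[]"] by simp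
  also have "\<dots> = braid_closure (braid_of (half_turn @ w @ word_inv half_turn))"
    using braid_of_context[OF half_turn_word[of w], of "[]" "word_inv half_turn"] by simp
  also have "\<dots> = braid_closure (braid_of (w @ word_inv half_turn @ half_turn))"
    using braid_closure_commute[of half_turn "w @ word_inv half_turn"] by simp
  also have "\<dots> = braid_closure (braid_of w)"
    using braid_of_cancel_word(2)[of w half_turn "[]"] by simp
  finally show ?thesis .
qed


section \<open>Alternating words\<close>

fun alt :: "braid_gen \<Rightarrow> bool \<Rightarrow> nat list \<Rightarrow> braid_word" where
  "alt g e [] = []"
| "alt g e (a # c) = replicate a (g, e) @ alt (other g) (\<not> e) c"

lemma alt_append:
  "alt g e (c @ d) = alt g e c @ (if even (length c) then alt g e d else alt (other g) (\<not> e) d)"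
  by (induction c arbitrary: g e) simp_all

lemma flip_alt: "flip (alt g e c) = alt g (\<not> e) c"
  by (induction c arbitrary: g e) (simp_all add: flip_def)

lemma map_other_alt: "map (apfst other) (alt g e c) = alt (other g) e c"
  by (induction c arbitrary: g e) simp_all

lemma rev_alt:
  "rev (alt g e c) = (if even (length c) then alt (other g) (\<not> e) (rev c) else alt g e (rev c))"
  by (induction c arbitrary: g e) (simp_all add: alt_append)

lemma beta_alt: "even (length c) \<Longrightarrow> beta c = braid_of (alt Sigma1 True c)"
proof (induction c rule: beta.induct)
  case (3 a b c)
  interpret group B3 by (rule group_B3)
  have pow: "braid_of [x] [^]\<^bsub>B3\<^esub> k = braid_of (replicate k x)" for x and k :: nat
  proof (induction k)
    case (Suc k)
    have "replicate (Suc k) x = replicate k x @ [x]" by (simp add: replicate_append_same)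
    then show ?case using Suc by (simp only: nat_pow_Suc braid_of_append)
  qed simp
  have "sigma2 [^]\<^bsub>B3\<^esub> (- int b) = braid_of (word_inv (replicate b (Sigma2, True)))"
    by (simp add: int_pow_neg_int sigma2_def pow braid_of_word_inv)
  then show ?case
    using 3 by (simp add: sigma1_def pow braid_of_append word_inv_def)
qed simp_all

lemma words_even: "c \<in> words n \<Longrightarrow> even (length c)"
  by (simp add: words_def)

lemma rev_words: "c \<in> words n \<Longrightarrow> rev c \<in> words n"
  by (simp add: words_def)

lemma rotate_words: "c \<in> words n \<Longrightarrow> rotate k c \<in> words n"
  by (simp add: words_def)

lemma braid_closure_beta_rotate1:
  assumes "c \<in> words n"
  shows "braid_closure (beta (rotate1 c)) = mirror ` braid_closure (beta c)"
proof (cases c)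
  case (Cons a d)
  then have odd: "odd (length d)" using words_even[OF assms] by simp
  have "mirror ` braid_closure (beta c) = braid_closure (braid_of (alt Sigma1 False c))"
    using words_even[OF assms] by (simp add: beta_alt mirror_braid_closure flip_alt)
  also have "\<dots> = braid_closure (braid_of (alt Sigma2 True d @ replicate a (Sigma1, False)))"
    using braid_closure_commute[of "replicate a (Sigma1, False)" "alt Sigma2 True d"] by (simp add: Cons)
  also have "alt Sigma2 True d @ replicate a (Sigma1, False) = alt Sigma2 True (rotate1 c)"
    using odd by (simp add: Cons alt_append)
  also have "braid_closure (braid_of \<dots>) = braid_closure (braid_of (alt Sigma1 True (rotate1 c)))"
    using braid_closure_swap[of "alt Sigma1 True (rotate1 c)"] by (simp add: map_other_alt)
  also have "\<dots> = braid_closure (beta (rotate1 c))"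
    using words_even[OF assms] by (simp add: beta_alt)
  finally show ?thesis ..
next
  case Nil
  then show ?thesis using mirror_braid_closure[of "[]"] by (simp add: flip_def)
qed

lemma braid_closure_beta_rev:
  assumes "c \<in> words n"
  shows "braid_closure (beta (rev c)) = (mirror \<circ> reverse) ` braid_closure (beta c)"
proof -
  have "(mirror \<circ> reverse) ` braid_closure (beta c) = braid_closure (braid_of (alt Sigma2 True (rev c)))"
    using words_even[OF assms]
    by (simp add: beta_alt mirror_braid_closure reverse_braid_closure flip_alt rev_alt flip: image_image)
  also have "\<dots> = braid_closure (braid_of (alt Sigma1 True (rev c)))"
    using braid_closure_swap[of "alt Sigma1 True (rev c)"] by (simp add: map_other_alt)
  also have "\<dots> = braid_closure (beta (rev c))"
    using words_even[OF assms] by (simp add: beta_alt)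
  finally show ?thesis ..
qed

lemma conjugate_beta_rotate2:
  assumes "c \<in> words n"
  shows "conjugate_in_B3 (beta (rotate1 (rotate1 c))) (beta c)"
proof -
  have ev: "even (length c)" using assms by (rule words_even)
  consider "c = []" | a b d where "c = a # b # d"
    using ev by (cases c rule: beta.cases) auto
  then show ?thesis
  proof cases
    case (2 a b d)
    have "beta c = braid_of (alt Sigma1 True [a, b] @ alt Sigma1 True d)"
      using beta_alt[OF ev] 2 by simp
    moreover have "beta (rotate1 (rotate1 c)) = braid_of (alt Sigma1 True d @ alt Sigma1 True [a, b])"
      using beta_alt[of "rotate1 (rotate1 c)"] 2 ev by (simp add: alt_append)
    ultimately show ?thesis by (simp only: conjugate_commute)
  qed (simp add: conjugate_refl)
qed

lemma conjugate_beta_rotate: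
  assumes "c \<in> words n"
  shows "conjugate_in_B3 (beta (rotate (2 * k) c)) (beta c)"
proof (induction k)
  case (Suc k)
  have "rotate (2 * Suc k) c = rotate1 (rotate1 (rotate (2 * k) c))" by simp
  then show ?case
    using conjugate_beta_rotate2[OF rotate_words[OF assms]] Suc conjugate_trans by metis
qed (simp add: conjugate_refl)

definition dih_op :: "int \<times> bool \<Rightarrow> olink \<Rightarrow> olink" where
  "dih_op g = (if odd (fst g) then mirror else id) \<circ> (if snd g then mirror \<circ> reverse else id)"

lemma braid_closure_beta_rotate:
  assumes "c \<in> words n"
  shows "braid_closure (beta (rotate k c)) = (if odd k then mirror else id) ` braid_closure (beta c)"
proof (induction k)
  case (Suc k)
  have "braid_closure (beta (rotate (Suc k) c)) = mirror ` (if odd k then mirror else id) ` braid_closure (beta c)"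
    using braid_closure_beta_rotate1[OF rotate_words[OF assms]] Suc by simp
  also have "\<dots> = (mirror \<circ> (if odd k then mirror else id)) ` braid_closure (beta c)"
    by (simp only: image_comp)
  also have "mirror \<circ> (if odd k then mirror else id) = (if odd (Suc k) then mirror else id)"
    using mirror_mirror by simp
  finally show ?case .
qed simp

lemma braid_closure_beta_dih_act:
  assumes "c \<in> words n" "g \<in> carrier (dihedral n)"
  shows "braid_closure (beta (dih_act g c)) = dih_op g ` braid_closure (beta c)"
proof -
  have "odd (nat (fst g)) \<longleftrightarrow> odd (fst g)"
    using assms(2) by (auto simp: dihedral_def even_nat_iff)
  moreover have "braid_closure (beta (if snd g then rev c else c))
      = (if snd g then mirror \<circ> reverse else id) ` braid_closure (beta c)"
    using braid_closure_beta_rev[OF assms(1)] by simp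
  moreover have "(if snd g then rev c else c) \<in> words n" using assms(1) rev_words by simp
  ultimately show ?thesis
    unfolding dih_act_def dih_op_def image_comp[symmetric] by (simp only: braid_closure_beta_rotate)
qed

lemma mult_dihedral:
  "(i, s) \<otimes>\<^bsub>dihedral n\<^esub> (j, t) = ((if s then i - j else i + j) mod (2 * int n), s \<noteq> t)"
  by (simp add: dihedral_def)

lemma dih_op_hom: "dih_op \<in> hom (dihedral n) link_ops"
proof (rule homI)
  show "dih_op g \<in> carrier link_ops" for g
    using mirror_mirror by (auto simp: dih_op_def link_ops_def simp flip: comp_assoc)
  fix g h :: "int \<times> bool"
  obtain i s j t where g: "g = (i, s)" "h = (j, t)" by (metis surj_pair)
  have par: "even (k mod (2 * int n)) \<longleftrightarrow> even k" for k by (simp add: dvd_mod_iff)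
  have rr: "reverse \<circ> (reverse \<circ> f) = f" "mirror \<circ> (mirror \<circ> f) = f"
    "reverse \<circ> (mirror \<circ> f) = mirror \<circ> (reverse \<circ> f)" for f :: "olink \<Rightarrow> olink"
    using mirror_mirror reverse_reverse mirror_reverse by (metis comp_assoc id_comp)+
  show "dih_op (g \<otimes>\<^bsub>dihedral n\<^esub> h) = dih_op g \<otimes>\<^bsub>link_ops\<^esub> dih_op h"
    unfolding g mult_dihedral
    by (cases s; cases t; cases "even i"; cases "even j")
      (simp_all add: dih_op_def link_ops_def par rr mirror_mirror reverse_reverse mirror_reverse comp_assoc
        flip: mirror_reverse)
qed

lemma dih_op_unique:
  assumes n: "n \<ge> 1" and \<psi>: "\<psi> \<in> hom (dihedral n) link_ops" and g: "g \<in> carrier (dihedral n)"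
    and "\<psi> dih_rho = dih_op dih_rho" "\<psi> dih_tau = dih_op dih_tau"
  shows "\<psi> g = dih_op g"
proof -
  obtain i s where gs: "g = (i, s)" by force
  have r: "dih_rho \<in> carrier (dihedral n)" and t: "dih_tau \<in> carrier (dihedral n)"
    using n by (auto simp: dihedral_def dih_rho_def dih_tau_def)
  have eval: "\<omega> g = \<omega> dih_rho [^]\<^bsub>link_ops\<^esub> nat i \<otimes>\<^bsub>link_ops\<^esub> (if s then \<omega> dih_tau else \<one>\<^bsub>link_ops\<^esub>)"
    if \<omega>: "\<omega> \<in> hom (dihedral n) link_ops" for \<omega>
  proof -
    interpret group_hom "dihedral n" link_ops \<omega>
      using \<omega> group_dihedral[OF n] group_link_ops by (simp add: group_hom_def group_hom_axioms_def)
    have "g = dih_rho [^]\<^bsub>dihedral n\<^esub> nat i \<otimes>\<^bsub>dihedral n\<^esub> (if s then dih_tau else \<one>\<^bsub>dihedral n\<^esub>)"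
      using dihedral_relations(4)[OF n] g gs by simp
    then show ?thesis using r t by (simp add: hom_nat_pow)
  qed
  show ?thesis unfolding eval[OF \<psi>] eval[OF dih_op_hom] assms(4,5) ..
qed

lemma dih_rho_int_pow:
  assumes "n \<ge> 1"
  shows "dih_rho [^]\<^bsub>dihedral n\<^esub> (j :: int) = (j mod (2 * int n), False)"
proof -
  interpret group "dihedral n" by (rule group_dihedral[OF assms])
  have r: "dih_rho \<in> carrier (dihedral n)" using assms by (simp add: dihedral_def dih_rho_def)
  have nat: "dih_rho [^]\<^bsub>dihedral n\<^esub> k = (int k mod (2 * int n), False)" for k :: nat
    by (induction k) (auto simp: dihedral_def dih_rho_def mod_simps algebra_simps)
  show ?thesis
  proof (cases j)
    case (nonneg k)
    then show ?thesis using nat[of k] by (simp add: int_pow_int)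
  next
    case (neg k)
    have "(j mod (2 * int n), False) \<otimes>\<^bsub>dihedral n\<^esub> dih_rho [^]\<^bsub>dihedral n\<^esub> Suc k = \<one>\<^bsub>dihedral n\<^esub>"
      unfolding nat mult_dihedral neg by (simp add: dihedral_def mod_simps)
    moreover have "(j mod (2 * int n), False) \<in> carrier (dihedral n)"
      using assms by (simp add: dihedral_def)
    ultimately have "inv\<^bsub>dihedral n\<^esub> (dih_rho [^]\<^bsub>dihedral n\<^esub> Suc k) = (j mod (2 * int n), False)"
      using r by (intro inv_equality nat_pow_closed)
    then show ?thesis unfolding neg using r by (simp only: int_pow_neg_int)
  qed
qed

theorem lemma4p7:
  fixes n :: nat
  assumes "n \<ge> 1"
  shows "\<exists>\<phi>\<in>hom (dihedral n) link_ops.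
    \<phi> ` carrier (dihedral n) = carrier link_ops \<and>
    \<phi> dih_rho = mirror \<and> \<phi> dih_tau = mirror \<circ> reverse \<and>
    (\<forall>\<psi>\<in>hom (dihedral n) link_ops. \<psi> dih_rho = mirror \<and> \<psi> dih_tau = mirror \<circ> reverse \<longrightarrow>
      (\<forall>g\<in>carrier (dihedral n). \<psi> g = \<phi> g)) \<and>
    (\<forall>c\<in>words n.
      braid_closure (beta (rotate1 c)) = mirror ` braid_closure (beta c) \<and>
      braid_closure (beta (rev c)) = (mirror \<circ> reverse) ` braid_closure (beta c) \<and>
      (\<forall>g\<in>carrier (dihedral n). braid_closure (beta (dih_act g c)) = \<phi> g ` braid_closure (beta c)) \<and>
      conjugate_in_B3 (beta (rotate1 (rotate1 c))) (beta c) \<and>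
      (\<forall>j::int.
        conjugate_in_B3 (beta (dih_act (dih_rho [^]\<^bsub>dihedral n\<^esub> (2 * j)) c)) (beta c) \<and>
        braid_closure (beta (dih_act (dih_rho [^]\<^bsub>dihedral n\<^esub> (2 * j)) c)) = braid_closure (beta c)))"
proof (intro bexI[of _ dih_op] conjI ballI allI impI dih_op_hom)
  show rho: "dih_op dih_rho = mirror" and tau: "dih_op dih_tau = mirror \<circ> reverse"
    by (simp_all add: dih_op_def dih_rho_def dih_tau_def)
  show "dih_op ` carrier (dihedral n) = carrier link_ops"
  proof
    show "dih_op ` carrier (dihedral n) \<subseteq> carrier link_ops"
      using dih_op_hom by (auto simp: hom_def)
    have "dih_op (0, False) = id" "dih_op (1, False) = mirror" "dih_op (0, True) = mirror \<circ> reverse"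
      "dih_op (1, True) = reverse"
      using mirror_mirror by (simp_all add: dih_op_def flip: comp_assoc)
    then have "carrier link_ops = dih_op ` ({0, 1} \<times> UNIV)"
      by (simp add: link_ops_def UNIV_bool insert_commute)
    also have "\<dots> \<subseteq> dih_op ` carrier (dihedral n)"
      by (intro image_mono) (use assms in \<open>auto simp: dihedral_def\<close>)
    finally show "carrier link_ops \<subseteq> dih_op ` carrier (dihedral n)" .
  qed
  fix \<psi> g
  assume "\<psi> \<in> hom (dihedral n) link_ops" "\<psi> dih_rho = mirror \<and> \<psi> dih_tau = mirror \<circ> reverse"
    "g \<in> carrier (dihedral n)"
  then show "\<psi> g = dih_op g" using dih_op_unique[OF assms] rho tau by simp
next
  fix c and j :: int assume c: "c \<in> words n"
  have "nat (2 * j mod (2 * int n)) = 2 * nat (j mod int n)"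
    using assms by (simp add: mult_mod_right[symmetric] nat_mult_distrib)
  then have "dih_act (dih_rho [^]\<^bsub>dihedral n\<^esub> (2 * j)) c = rotate (2 * nat (j mod int n)) c"
    by (simp add: dih_rho_int_pow[OF assms] dih_act_def)
  then show "conjugate_in_B3 (beta (dih_act (dih_rho [^]\<^bsub>dihedral n\<^esub> (2 * j)) c)) (beta c)"
    and "braid_closure (beta (dih_act (dih_rho [^]\<^bsub>dihedral n\<^esub> (2 * j)) c)) = braid_closure (beta c)"
    using conjugate_beta_rotate[OF c] braid_closure_beta_rotate[OF c] by simp_all
qed (fact braid_closure_beta_rotate1 braid_closure_beta_rev conjugate_beta_rotate2
    braid_closure_beta_dih_act)+

end
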